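(* Let $K$ be a field, $n\geq 1$, $S=K[x_1,\ldots,x_n]$, and let $I\subset S$ be a monomial ideal which is not principal. Assume $I=vI'$, where $v\in S$ is a monomial and $I'=(I:v)$. Then: (1) $\operatorname{sdepth}(S/I)=\operatorname{sdepth}(S/I')$. (2) $\operatorname{sdepth}(I)=\operatorname{sdepth}(I')$.
   Context: $S$ is given the standard $\mathbb{Z}^n$-grading, with $\deg x_i$ the $i$-th unit vector. Let $M\neq 0$ be a finitely generated $\mathbb{Z}^n$-graded $S$-module. A Stanley decomposition of $M$ is a direct sum decomposition of $K$-vector spaces $\mathcal{D}: M=\bigoplus_{i=1}^r m_iK[Z_i]$ where each $m_i\in M$ is homogeneous, $Z_i\subset\{x_1,\ldots,x_n\}$, and $m_iK[Z_i]$ is a free $K[Z_i]$-module. Put $\operatorname{sdepth}(\mathcal{D})=\min_{1\le i\le r}|Z_i|$. The Stanley depth of $M$ is $\operatorname{sdepth}(M)=\max\{\operatorname{sdepth}(\mathcal{D}) : \mathcal{D}\text{ a Stanley decomposition of }M\}$. The zero ideal counts as principal. *)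

theory Defs
  imports
    "HOL-Library.Poly_Mapping"
    "HOL-Algebra.QuotRing"
    "HOL-Algebra.Module"
    "HOL-Algebra.Algebraic_Closure_Type"
begin

text \<open>
  The variables are indexed by a finite type \<open>'n\<close>, so \<open>n = CARD('n) \<ge> 1\<close>; a set of
  variables is a set of indices. A term \<open>t :: 'n \<Rightarrow>\<^sub>0 nat\<close> is an exponent vector.
\<close>

type_synonym ('n, 'k) mpoly = "('n \<Rightarrow>\<^sub>0 nat) \<Rightarrow>\<^sub>0 'k"

abbreviation polyring :: "('n, 'k::field) mpoly ring" where
  "polyring \<equiv> ring_of_type_algebra"

definition monomials :: "('n, 'k::field) mpoly set" where
  "monomials = {Poly_Mapping.single t 1 |t. True}"

definition monomial_ideal :: "('n, 'k::field) mpoly set \<Rightarrow> bool" where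
  "monomial_ideal I \<longleftrightarrow> (\<exists>A \<subseteq> monomials. I = Idl\<^bsub>polyring\<^esub> A)"

definition colon_ideal :: "('n, 'k::field) mpoly set \<Rightarrow> ('n, 'k) mpoly \<Rightarrow> ('n, 'k) mpoly set" where
  "colon_ideal I v = {f. f * v \<in> I}"

definition poly_grade :: "('n \<Rightarrow> int) \<Rightarrow> ('n, 'k::field) mpoly set" where
  "poly_grade a = {f. \<forall>t \<in> Poly_Mapping.keys f. \<forall>i. int (Poly_Mapping.lookup t i) = a i}"

definition vars_subalgebra :: "'n set \<Rightarrow> ('n, 'k::field) mpoly ring" where
  "vars_subalgebra Z = polyring\<lparr>carrier := {f. \<forall>t \<in> Poly_Mapping.keys f. Poly_Mapping.keys t \<subseteq> Z}\<rparr>"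


section \<open>Direct sums, free modules, multigraded modules\<close>

text \<open>\<open>M\<close> is the internal direct sum of its additive subgroups \<open>N j\<close>, \<open>j \<in> J\<close>.\<close>

definition is_direct_sum :: "('b, 'm) ring_scheme \<Rightarrow> 'j set \<Rightarrow> ('j \<Rightarrow> 'b set) \<Rightarrow> bool" where
  "is_direct_sum M J N \<longleftrightarrow>
     (\<forall>j\<in>J. additive_subgroup (N j) M) \<and>
     (\<forall>x\<in>carrier M. \<exists>!c. c \<in> (\<Pi>\<^sub>E j\<in>J. N j) \<and> finite {j\<in>J. c j \<noteq> \<zero>\<^bsub>M\<^esub>} \<and>
        x = (\<Oplus>\<^bsub>M\<^esub> j \<in> {j\<in>J. c j \<noteq> \<zero>\<^bsub>M\<^esub>}. c j))"

text \<open>\<open>M\<close> has a basis \<open>B\<close>, i.e. every element is an \<open>R\<close>-linear combination of \<open>B\<close> in a unique way.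
  The zero module is free (on the empty basis).\<close>

definition free_module :: "('a, 'r) ring_scheme \<Rightarrow> ('a, 'b, 'm) module_scheme \<Rightarrow> bool" where
  "free_module R M \<longleftrightarrow> module R M \<and>
     (\<exists>B \<subseteq> carrier M. \<forall>x\<in>carrier M. \<exists>!c. c \<in> (B \<rightarrow>\<^sub>E carrier R) \<and>
        finite {b\<in>B. c b \<noteq> \<zero>\<^bsub>R\<^esub>} \<and>
        x = (\<Oplus>\<^bsub>M\<^esub> b \<in> {b\<in>B. c b \<noteq> \<zero>\<^bsub>R\<^esub>}. c b \<odot>\<^bsub>M\<^esub> b))"

text \<open>Library modules extend rings, but the locale \<^locale>\<open>module\<close> ignores the fields
  \<^const>\<open>mult\<close> and \<^const>\<open>one\<close> of the module.\<close>

record ('a, 'b, 'n) graded_module = "('a, 'b) module" +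
  grade :: "('n \<Rightarrow> int) \<Rightarrow> 'b set"

definition multigraded_module :: "(('n, 'k::field) mpoly, 'b, 'n) graded_module \<Rightarrow> bool" where
  "multigraded_module M \<longleftrightarrow>
     module polyring M \<and> is_direct_sum M UNIV (grade M) \<and>
     (\<forall>a b. \<forall>f \<in> poly_grade a. \<forall>x \<in> grade M b. f \<odot>\<^bsub>M\<^esub> x \<in> grade M (\<lambda>i. a i + b i))"


section \<open>Stanley decompositions and Stanley depth\<close>

definition stanley_space ::
    "(('n, 'k::field) mpoly, 'b, 'n) graded_module \<Rightarrow> 'b \<Rightarrow> 'n set \<Rightarrow> 'b set" where
  "stanley_space M m Z = {f \<odot>\<^bsub>M\<^esub> m |f. f \<in> carrier (vars_subalgebra Z)}"

text \<open>A decomposition \<open>M = m\<^sub>1K[Z\<^sub>1] \<oplus> \<dots> \<oplus> m\<^sub>rK[Z\<^sub>r]\<close> is given by the list of the pairs \<open>(m\<^sub>i, Z\<^sub>i)\<close>.\<close>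

definition stanley_decomposition ::
    "(('n, 'k::field) mpoly, 'b, 'n) graded_module \<Rightarrow> ('b \<times> 'n set) list \<Rightarrow> bool" where
  "stanley_decomposition M D \<longleftrightarrow>
     (\<forall>(m, Z) \<in> set D. m \<in> carrier M \<and> (\<exists>a. m \<in> grade M a) \<and>
        free_module (vars_subalgebra Z) (M\<lparr>carrier := stanley_space M m Z\<rparr>)) \<and>
     is_direct_sum M {..<length D} (\<lambda>i. stanley_space M (fst (D ! i)) (snd (D ! i)))"

definition sdepth_decomposition :: "('b \<times> 'n set) list \<Rightarrow> nat" where
  "sdepth_decomposition D = Min {card Z |m Z. (m, Z) \<in> set D}"

text \<open>Meant for finitely generated multigraded \<open>M \<noteq> 0\<close>; then the set is nonempty,
  and bounded by the number of variables.\<close>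

definition sdepth :: "(('n::finite, 'k::field) mpoly, 'b, 'n) graded_module \<Rightarrow> nat" where
  "sdepth M = Max {sdepth_decomposition D |D. stanley_decomposition M D}"


section \<open>The multigraded modules \<open>I\<close> and \<open>S/I\<close>\<close>

definition ideal_module ::
    "('n, 'k::field) mpoly set \<Rightarrow> (('n, 'k) mpoly, ('n, 'k) mpoly, 'n) graded_module" where
  "ideal_module I =
     \<lparr>carrier = I, monoid.mult = (*), one = 1, ring.zero = 0, add = (+), module.smult = (*),
      grade = (\<lambda>a. I \<inter> poly_grade a)\<rparr>"

definition quotient_module ::
    "('n, 'k::field) mpoly set \<Rightarrow> (('n, 'k) mpoly, ('n, 'k) mpoly set, 'n) graded_module" where
  "quotient_module I = (let Q = polyring Quot I in
     \<lparr>carrier = carrier Q, monoid.mult = monoid.mult Q, one = one Q,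
      ring.zero = ring.zero Q, add = add Q,
      module.smult = (\<lambda>f y. (I +>\<^bsub>polyring\<^esub> f) \<otimes>\<^bsub>Q\<^esub> y),
      grade = (\<lambda>a. (\<lambda>f. I +>\<^bsub>polyring\<^esub> f) ` poly_grade a)\<rparr>)"


section \<open>\<open>I\<close> and \<open>S/I\<close> are multigraded modules\<close>

lemma polyring_simps [simp]:
  "carrier (polyring :: ('n, 'k::field) mpoly ring) = UNIV"
  "x \<otimes>\<^bsub>(polyring :: ('n, 'k) mpoly ring)\<^esub> y = x * y"
  "\<one>\<^bsub>(polyring :: ('n, 'k) mpoly ring)\<^esub> = 1"
  "\<zero>\<^bsub>(polyring :: ('n, 'k) mpoly ring)\<^esub> = 0"
  "x \<oplus>\<^bsub>(polyring :: ('n, 'k) mpoly ring)\<^esub> y = x + y"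
  by (simp_all add: ring_of_type_algebra_def)

lemma cring_polyring: "cring (polyring :: ('n, 'k::field) mpoly ring)"
  by (rule cring_from_type_algebra)

lemma ideal_polyringI:
  fixes I :: "('n, 'k::field) mpoly set"
  assumes "0 \<in> I" "\<And>f g. f \<in> I \<Longrightarrow> g \<in> I \<Longrightarrow> f + g \<in> I" "\<And>f g. f \<in> I \<Longrightarrow> g * f \<in> I"
  shows "ideal I polyring"
proof (rule idealI)
  interpret cring "polyring :: ('n, 'k) mpoly ring" by (rule cring_polyring)
  show "ring (polyring :: ('n, 'k) mpoly ring)" by (rule ring_axioms)
  show "subgroup I (add_monoid polyring)"
  proof (rule add.subgroupI)
    fix f assume f: "f \<in> I"
    have "\<ominus>\<^bsub>polyring\<^esub> f = - 1 * f"
      by (rule minus_equality) simp_all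
    then show "\<ominus>\<^bsub>polyring\<^esub> f \<in> I"
      using assms(3)[OF f, of "- 1"] by simp
  qed (use assms in auto)
qed (use assms(3) in \<open>auto simp: mult.commute\<close>)

lemma ideal_polyringD:
  fixes I :: "('n, 'k::field) mpoly set"
  assumes "ideal I polyring"
  shows "0 \<in> I" "f \<in> I \<Longrightarrow> g \<in> I \<Longrightarrow> f + g \<in> I" "f \<in> I \<Longrightarrow> g * f \<in> I"
    "f \<in> I \<Longrightarrow> - f \<in> I" "f \<in> I \<Longrightarrow> g \<in> I \<Longrightarrow> f - g \<in> I" "(\<And>j. j \<in> J \<Longrightarrow> h j \<in> I) \<Longrightarrow> sum h J \<in> I"
proof -
  interpret ideal I polyring by fact
  show "0 \<in> I" using additive_subgroup.zero_closed[OF is_additive_subgroup] by simp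
  then have 0: "0 \<in> I" .
  have add: "f + g \<in> I" if "f \<in> I" "g \<in> I" for f g using additive_subgroup.a_closed[OF is_additive_subgroup that] by simp
  have mul: "g * f \<in> I" if "f \<in> I" for f g using I_l_closed[OF that, of g] by simp
  have neg: "- f \<in> I" if "f \<in> I" for f using mul[OF that, of "- 1"] by simp
  show "f + g \<in> I" if "f \<in> I" "g \<in> I" using that by (rule add)
  show "g * f \<in> I" if "f \<in> I" using that by (rule mul)
  show "- f \<in> I" if "f \<in> I" using that by (rule neg)
  show "f - g \<in> I" if "f \<in> I" "g \<in> I" using add[OF that(1) neg[OF that(2)]] by simp
  show "sum h J \<in> I" if "\<And>j. j \<in> J \<Longrightarrow> h j \<in> I"
    using that by (induction J rule: infinite_finite_induct) (auto simp: 0 add)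
qed

definition degree_vec :: "('n \<Rightarrow>\<^sub>0 nat) \<Rightarrow> 'n \<Rightarrow> int" where
  "degree_vec t = (\<lambda>i. int (Poly_Mapping.lookup t i))"

text \<open>The homogeneous component of degree \<open>a\<close>.\<close>

definition hcomp :: "('n \<Rightarrow> int) \<Rightarrow> ('n, 'k::field) mpoly \<Rightarrow> ('n, 'k) mpoly" where
  "hcomp a f = (\<Sum>t \<in> {t \<in> Poly_Mapping.keys f. degree_vec t = a}.
     Poly_Mapping.single t (Poly_Mapping.lookup f t))"

lemma poly_grade_eq: "poly_grade a = {f. \<forall>t \<in> Poly_Mapping.keys f. degree_vec t = a}"
  by (auto simp: poly_grade_def degree_vec_def fun_eq_iff)

lemma lookup_hcomp:
  "Poly_Mapping.lookup (hcomp a f) t = (if degree_vec t = a then Poly_Mapping.lookup f t else 0)"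
proof -
  have "Poly_Mapping.lookup (hcomp a f) t = (\<Sum>s \<in> {s \<in> Poly_Mapping.keys f. degree_vec s = a}.
      if s = t then Poly_Mapping.lookup f t else 0)"
    unfolding hcomp_def lookup_sum by (rule sum.cong) (auto simp: lookup_single when_def)
  also have "\<dots> = (if degree_vec t = a then Poly_Mapping.lookup f t else 0)"
    by (subst sum.delta) (auto simp: in_keys_iff)
  finally show ?thesis .
qed

lemma hcomp_grade: "hcomp a f \<in> poly_grade a"
  by (auto simp: poly_grade_eq in_keys_iff lookup_hcomp split: if_splits)

lemma hcomp_diff: "hcomp a (f - g) = hcomp a f - hcomp a g"
  by (rule poly_mapping_eqI) (simp add: lookup_hcomp lookup_minus)

lemma hcomp_zero [simp]: "hcomp a 0 = 0"
  by (rule poly_mapping_eqI) (simp add: lookup_hcomp)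

lemma hcomp_same: "f \<in> poly_grade a \<Longrightarrow> hcomp b f = (if b = a then f else 0)"
  by (rule poly_mapping_eqI) (auto simp: lookup_hcomp poly_grade_eq in_keys_iff)

lemma hcomp_sum: "hcomp a (sum h J) = (\<Sum>j\<in>J. hcomp a (h j))"
  by (rule poly_mapping_eqI) (simp add: lookup_hcomp lookup_sum)

lemma hcomp_eq_0: "a \<notin> degree_vec ` Poly_Mapping.keys f \<Longrightarrow> hcomp a f = 0"
  by (rule poly_mapping_eqI) (auto simp: lookup_hcomp in_keys_iff)

lemma sum_hcomp:
  assumes "finite A" "degree_vec ` Poly_Mapping.keys f \<subseteq> A"
  shows "(\<Sum>a\<in>A. hcomp a f) = f"
proof (rule poly_mapping_eqI)
  fix t
  have "Poly_Mapping.lookup (\<Sum>a\<in>A. hcomp a f) t =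
      (\<Sum>a\<in>A. if degree_vec t = a then Poly_Mapping.lookup f t else 0)"
    by (simp add: lookup_sum lookup_hcomp)
  also have "\<dots> = Poly_Mapping.lookup f t"
    using assms(2) by (subst sum.delta'[OF assms(1)])
      (auto simp: in_keys_iff image_subset_iff)
  finally show "Poly_Mapping.lookup (\<Sum>a\<in>A. hcomp a f) t = Poly_Mapping.lookup f t" .
qed

lemma poly_grade_closed:
  "0 \<in> poly_grade a"
  "f \<in> poly_grade a \<Longrightarrow> g \<in> poly_grade a \<Longrightarrow> f + g \<in> poly_grade a"
  "f \<in> poly_grade a \<Longrightarrow> - f \<in> poly_grade a"
  using keys_add[of f g] by (auto simp: poly_grade_eq in_keys_iff)

lemma poly_grade_mult:
  "f \<in> poly_grade a \<Longrightarrow> g \<in> poly_grade b \<Longrightarrow> f * g \<in> poly_grade (\<lambda>i. a i + b i)"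
  using keys_mult[of f g] by (fastforce simp: poly_grade_def lookup_add)

lemma monomial_ideal_is_ideal:
  "monomial_ideal (I :: ('n, 'k::field) mpoly set) \<Longrightarrow> ideal I polyring"
proof -
  interpret cring "polyring :: ('n, 'k) mpoly ring" by (rule cring_polyring)
  show "monomial_ideal I \<Longrightarrow> ideal I polyring"
    by (auto simp: monomial_ideal_def intro: genideal_ideal)
qed

lemma monomial_ideal_term:
  fixes I :: "('n, 'k::field) mpoly set"
  assumes I: "monomial_ideal I" and "f \<in> I" "t \<in> Poly_Mapping.keys f"
  shows "Poly_Mapping.single t 1 \<in> I"
proof -
  interpret cring "polyring :: ('n, 'k) mpoly ring" by (rule cring_polyring)
  obtain A where A: "A \<subseteq> monomials" "I = Idl\<^bsub>polyring\<^esub> A"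
    using I by (auto simp: monomial_ideal_def)
  let ?J = "{f :: ('n, 'k) mpoly. \<forall>t \<in> Poly_Mapping.keys f. Poly_Mapping.single t 1 \<in> I}"
  have "ideal ?J polyring"
  proof (rule ideal_polyringI)
    fix f g assume f: "f \<in> ?J"
    show "f + g \<in> ?J" if "g \<in> ?J"
      using f that keys_add[of f g] by blast
    show "g * f \<in> ?J"
    proof (clarify)
      fix t assume "t \<in> Poly_Mapping.keys (g * f)"
      then obtain r s where rs: "t = r + s" "s \<in> Poly_Mapping.keys f"
        using keys_mult[of g f] by blast
      then have "Poly_Mapping.single r 1 * Poly_Mapping.single s 1 \<in> I"
        using f by (auto intro: ideal_polyringD(3)[OF monomial_ideal_is_ideal[OF I]])
      then show "Poly_Mapping.single t 1 \<in> I"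
        by (simp add: rs mult_single)
    qed
  qed simp
  moreover have "A \<subseteq> ?J"
  proof
    fix f assume f: "f \<in> A"
    then have "f \<in> I" using A genideal_self[of A] by auto
    then show "f \<in> ?J" using A(1) f by (auto simp: monomials_def)
  qed
  ultimately have "I \<subseteq> ?J"
    unfolding A(2) by (rule genideal_minimal)
  then show ?thesis
    using assms by blast
qed

lemma monomial_ideal_hcomp:
  fixes I :: "('n, 'k::field) mpoly set"
  assumes I: "monomial_ideal I" and f: "f \<in> I"
  shows "hcomp a f \<in> I"
  unfolding hcomp_def
proof (rule ideal_polyringD(6)[OF monomial_ideal_is_ideal[OF I]])
  fix t assume "t \<in> {t \<in> Poly_Mapping.keys f. degree_vec t = a}"
  then have "Poly_Mapping.single t 1 \<in> I"
    using monomial_ideal_term[OF I f] by blast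
  from ideal_polyringD(3)[OF monomial_ideal_is_ideal[OF I] this,
      of "Poly_Mapping.single 0 (Poly_Mapping.lookup f t)"]
  show "Poly_Mapping.single t (Poly_Mapping.lookup f t) \<in> I"
    by (simp add: mult_single)
qed

lemma ideal_module_simps [simp]:
  "carrier (ideal_module I) = I" "\<zero>\<^bsub>ideal_module I\<^esub> = 0"
  "x \<oplus>\<^bsub>ideal_module I\<^esub> y = x + y" "f \<odot>\<^bsub>ideal_module I\<^esub> x = f * x"
  "grade (ideal_module I) = (\<lambda>a. I \<inter> poly_grade a)"
  by (simp_all add: ideal_module_def)

lemma module_ideal_module:
  fixes I :: "('n, 'k::field) mpoly set"
  assumes I: "ideal I polyring"
  shows "module polyring (ideal_module I)"
proof (rule moduleI)
  note D = ideal_polyringD[OF I]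
  show "abelian_group (ideal_module I)"
    by (rule abelian_groupI) (auto simp: D algebra_simps intro!: bexI[of _ "- _"])
qed (auto simp: cring_polyring ideal_polyringD[OF I] algebra_simps)

lemma finsum_ideal_module:
  fixes I :: "('n, 'k::field) mpoly set"
  assumes I: "ideal I polyring" and c: "\<And>j. j \<in> J \<Longrightarrow> c j \<in> I"
  shows "finsum (ideal_module I) c J = sum c J"
proof -
  interpret module polyring "ideal_module I" by (rule module_ideal_module[OF I])
  show ?thesis using c
    by (induction J rule: infinite_finite_induct)
       (auto simp: M.add.finprod_infinite Pi_iff)
qed

theorem multigraded_ideal_module:
  fixes I :: "('n, 'k::field) mpoly set"
  assumes mon: "monomial_ideal I"
  shows "multigraded_module (ideal_module I)"
proof -
  have I: "ideal I polyring" by (rule monomial_ideal_is_ideal[OF mon])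
  note D = ideal_polyringD[OF I]
  interpret module polyring "ideal_module I" by (rule module_ideal_module[OF I])
  have sub: "additive_subgroup (I \<inter> poly_grade a) (ideal_module I)" for a
  proof (rule additive_subgroupI, rule M.add.subgroupI)
    fix f assume f: "f \<in> I \<inter> poly_grade a"
    have "\<ominus>\<^bsub>ideal_module I\<^esub> f = - f"
      by (rule M.minus_equality) (use f D in auto)
    then show "\<ominus>\<^bsub>ideal_module I\<^esub> f \<in> I \<inter> poly_grade a"
      using f D poly_grade_closed by auto
  next
    show "I \<inter> poly_grade a \<noteq> {}"
      using D(1) poly_grade_closed(1) by blast
  qed (use D poly_grade_closed in auto)
  have "\<exists>!c. c \<in> (\<Pi>\<^sub>E a\<in>UNIV. I \<inter> poly_grade a) \<and> finite {a\<in>UNIV. c a \<noteq> 0} \<and>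
      f = finsum (ideal_module I) c {a\<in>UNIV. c a \<noteq> 0}" if f: "f \<in> I" for f
  proof (rule ex1I[of _ "\<lambda>a. hcomp a f"])
    let ?A = "{a \<in> UNIV. hcomp a f \<noteq> 0}"
    have A: "?A \<subseteq> degree_vec ` Poly_Mapping.keys f"
      using hcomp_eq_0 by blast
    have "finsum (ideal_module I) (\<lambda>a. hcomp a f) ?A = (\<Sum>a\<in>?A. hcomp a f)"
      by (rule finsum_ideal_module[OF I]) (rule monomial_ideal_hcomp[OF mon f])
    also have "\<dots> = (\<Sum>a\<in>degree_vec ` Poly_Mapping.keys f. hcomp a f)"
      using A by (intro sum.mono_neutral_left) auto
    also have "\<dots> = f" by (rule sum_hcomp) auto
    finally show "(\<lambda>a. hcomp a f) \<in> (\<Pi>\<^sub>E a\<in>UNIV. I \<inter> poly_grade a) \<and> finite ?A \<and>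
        f = finsum (ideal_module I) (\<lambda>a. hcomp a f) ?A"
      using finite_subset[OF A] by (auto simp: hcomp_grade monomial_ideal_hcomp[OF mon f])
  next
    fix c assume c: "c \<in> (\<Pi>\<^sub>E a\<in>UNIV. I \<inter> poly_grade a) \<and> finite {a\<in>UNIV. c a \<noteq> 0} \<and>
      f = finsum (ideal_module I) c {a\<in>UNIV. c a \<noteq> 0}"
    have cI: "c a \<in> I" and cg: "c a \<in> poly_grade a" for a
      using c by (auto simp: PiE_iff)
    have f_eq: "f = sum c {a\<in>UNIV. c a \<noteq> 0}"
      using c finsum_ideal_module[OF I, of "{a\<in>UNIV. c a \<noteq> 0}" c] cI by simp
    show "c = (\<lambda>a. hcomp a f)"
    proof
      fix b
      have "hcomp b f = (\<Sum>a\<in>{a\<in>UNIV. c a \<noteq> 0}. if b = a then c a else 0)"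
        unfolding f_eq hcomp_sum by (rule sum.cong) (auto simp: hcomp_same[OF cg])
      also have "\<dots> = c b"
        using c by (subst sum.delta') auto
      finally show "c b = hcomp b f" ..
    qed
  qed
  then show ?thesis
    unfolding multigraded_module_def is_direct_sum_def
    using sub D module_axioms poly_grade_mult by auto
qed

lemma quotient_module_simps:
  "carrier (quotient_module I) = carrier (polyring Quot I)"
  "\<zero>\<^bsub>quotient_module I\<^esub> = \<zero>\<^bsub>polyring Quot I\<^esub>"
  "x \<oplus>\<^bsub>quotient_module I\<^esub> y = x \<oplus>\<^bsub>polyring Quot I\<^esub> y"
  "f \<odot>\<^bsub>quotient_module I\<^esub> x = (I +>\<^bsub>polyring\<^esub> f) \<otimes>\<^bsub>polyring Quot I\<^esub> x"
  "grade (quotient_module I) a = (\<lambda>f. I +>\<^bsub>polyring\<^esub> f) ` poly_grade a"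
  by (simp_all add: quotient_module_def Let_def)

lemma finsum_quotient_module: "finsum (quotient_module I) = finsum (polyring Quot I)"
  by (simp add: finsum_def finprod_def quotient_module_def Let_def fun_eq_iff)

lemma module_quotient_module:
  fixes I :: "('n, 'k::field) mpoly set"
  assumes I: "ideal I polyring"
  shows "module polyring (quotient_module I)"
proof -
  interpret h: ring_hom_cring polyring "polyring Quot I" "(+>\<^bsub>polyring\<^esub>) I"
    by (rule ideal.rcos_ring_hom_cring[OF I cring_polyring])
  have carr: "I +>\<^bsub>polyring\<^esub> f \<in> carrier (polyring Quot I)" for f
    using h.hom_closed[of f] by simp
  have hom: "I +>\<^bsub>polyring\<^esub> (f + g) = (I +>\<^bsub>polyring\<^esub> f) \<oplus>\<^bsub>polyring Quot I\<^esub> (I +>\<^bsub>polyring\<^esub> g)"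
    "I +>\<^bsub>polyring\<^esub> (f * g) = (I +>\<^bsub>polyring\<^esub> f) \<otimes>\<^bsub>polyring Quot I\<^esub> (I +>\<^bsub>polyring\<^esub> g)"
    "I +>\<^bsub>polyring\<^esub> 1 = \<one>\<^bsub>polyring Quot I\<^esub>" for f g
    using h.hom_add[of f g] h.hom_mult[of f g] h.hom_one by simp_all
  show ?thesis
  proof (rule moduleI)
    show "cring (polyring :: ('n, 'k) mpoly ring)" by (rule cring_polyring)
    show "abelian_group (quotient_module I)"
    proof (rule abelian_groupI)
      show "x \<oplus>\<^bsub>quotient_module I\<^esub> y = y \<oplus>\<^bsub>quotient_module I\<^esub> x"
        if "x \<in> carrier (quotient_module I)" "y \<in> carrier (quotient_module I)" for x y
        using that by (simp add: quotient_module_simps h.S.a_comm)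
    qed (auto simp: quotient_module_simps h.S.a_assoc
        intro: bexI[of _ "\<ominus>\<^bsub>polyring Quot I\<^esub> _"] h.S.l_neg)
  qed (simp_all add: quotient_module_simps carr hom h.S.l_distr h.S.r_distr h.S.m_assoc)
qed

lemma finsum_polyring: "finsum (polyring :: ('n, 'k::field) mpoly ring) c J = sum c J"
proof -
  interpret cring "polyring :: ('n, 'k) mpoly ring" by (rule cring_polyring)
  show ?thesis
    by (induction J rule: infinite_finite_induct) (auto simp: add.finprod_infinite)
qed

theorem multigraded_quotient_module:
  fixes I :: "('n, 'k::field) mpoly set"
  assumes mon: "monomial_ideal I"
  shows "multigraded_module (quotient_module I)"
proof -
  have I: "ideal I polyring" by (rule monomial_ideal_is_ideal[OF mon])
  note D = ideal_polyringD[OF I]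
  define Q where "Q = polyring Quot I"
  define p where "p = (+>\<^bsub>polyring\<^esub>) I"
  interpret h: ring_hom_cring polyring Q p
    unfolding Q_def p_def by (rule ideal.rcos_ring_hom_cring[OF I cring_polyring])
  have p_carr: "p f \<in> carrier Q" for f
    using h.hom_closed[of f] by simp
  have p_add: "p (f + g) = p f \<oplus>\<^bsub>Q\<^esub> p g" and p_mult: "p (f * g) = p f \<otimes>\<^bsub>Q\<^esub> p g" for f g
    using h.hom_add[of f g] h.hom_mult[of f g] by simp_all
  have p_0: "p 0 = \<zero>\<^bsub>Q\<^esub>"
    using h.hom_zero by simp
  have minus: "\<ominus>\<^bsub>polyring\<^esub> f = - f" for f :: "('n, 'k) mpoly"
    by (rule h.R.minus_equality) simp_all
  have p_neg: "p (- f) = \<ominus>\<^bsub>Q\<^esub> p f" for f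
    using h.hom_a_inv[of f] by (simp add: minus)
  have p_eq: "p f = p g \<longleftrightarrow> f - g \<in> I" for f g
    using h.R.quotient_eq_iff_same_a_r_cos[OF I, of f g]
    by (auto simp: p_def a_minus_def minus)
  have p_sum: "finsum Q (\<lambda>j. p (h j)) J = p (sum h J)" for h :: "('n \<Rightarrow> int) \<Rightarrow> _" and J
    using h.hom_finsum[of h J] by (simp add: finsum_polyring o_def)
  have p_surj: "\<exists>f. x = p f" if "x \<in> carrier Q" for x
    using that by (auto simp: Q_def p_def FactRing_def A_RCOSETS_def')
  note simps = quotient_module_simps[of I, folded Q_def p_def]
  interpret module polyring "quotient_module I" by (rule module_quotient_module[OF I])
  have sub: "additive_subgroup (p ` poly_grade a) (quotient_module I)" for a
  proof (rule additive_subgroupI, rule M.add.subgroupI)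
    show "p ` poly_grade a \<subseteq> carrier (quotient_module I)"
      by (auto simp: simps p_carr)
    show "p ` poly_grade a \<noteq> {}"
      using poly_grade_closed(1) by blast
    fix x assume "x \<in> p ` poly_grade a"
    then obtain f where f: "f \<in> poly_grade a" "x = p f" by blast
    have "\<ominus>\<^bsub>quotient_module I\<^esub> x = p (- f)"
      by (rule M.minus_equality) (simp_all add: simps f p_carr p_neg h.S.l_neg)
    then show "\<ominus>\<^bsub>quotient_module I\<^esub> x \<in> p ` poly_grade a"
      using f poly_grade_closed(3) by blast
    fix y assume "y \<in> p ` poly_grade a"
    then obtain g where g: "g \<in> poly_grade a" "y = p g" by blast
    have "x \<oplus>\<^bsub>quotient_module I\<^esub> y = p (f + g)"
      by (simp add: simps f g p_add)
    then show "x \<oplus>\<^bsub>quotient_module I\<^esub> y \<in> p ` poly_grade a"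
      using f g poly_grade_closed(2)[of f a g] by simp
  qed
  have dec: "\<exists>!c. c \<in> (\<Pi>\<^sub>E a\<in>UNIV. p ` poly_grade a) \<and> finite {a\<in>UNIV. c a \<noteq> \<zero>\<^bsub>Q\<^esub>} \<and>
      x = finsum Q c {a\<in>UNIV. c a \<noteq> \<zero>\<^bsub>Q\<^esub>}" if x: "x \<in> carrier Q" for x
  proof -
    obtain f where f: "x = p f" using p_surj[OF x] by blast
    show ?thesis
    proof (rule ex1I[of _ "\<lambda>a. p (hcomp a f)"])
      let ?A = "{a \<in> UNIV. p (hcomp a f) \<noteq> \<zero>\<^bsub>Q\<^esub>}"
      let ?B = "degree_vec ` Poly_Mapping.keys f"
      have A: "?A \<subseteq> ?B"
        using hcomp_eq_0[of _ f] by (auto simp: p_0)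
      have "(\<Sum>a\<in>?B. hcomp a f) = (\<Sum>a\<in>?A. hcomp a f) + (\<Sum>a\<in>?B - ?A. hcomp a f)"
        using sum.subset_diff[OF A, of "\<lambda>a. hcomp a f"] by (simp add: add.commute)
      moreover have "(\<Sum>a\<in>?B - ?A. hcomp a f) \<in> I"
        by (rule D(6)) (use p_eq[of _ 0] in \<open>auto simp: p_0\<close>)
      ultimately have "p (\<Sum>a\<in>?A. hcomp a f) = p (\<Sum>a\<in>?B. hcomp a f)"
        unfolding p_eq using D(4) by simp
      then have "finsum Q (\<lambda>a. p (hcomp a f)) ?A = x"
        unfolding p_sum by (simp add: f sum_hcomp)
      then show "(\<lambda>a. p (hcomp a f)) \<in> (\<Pi>\<^sub>E a\<in>UNIV. p ` poly_grade a) \<and> finite ?A \<and>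
          x = finsum Q (\<lambda>a. p (hcomp a f)) ?A"
        using finite_subset[OF A] by (auto simp: hcomp_grade)
    next
      fix c assume c: "c \<in> (\<Pi>\<^sub>E a\<in>UNIV. p ` poly_grade a) \<and> finite {a\<in>UNIV. c a \<noteq> \<zero>\<^bsub>Q\<^esub>} \<and>
        x = finsum Q c {a\<in>UNIV. c a \<noteq> \<zero>\<^bsub>Q\<^esub>}"
      then have "\<forall>a. \<exists>g. g \<in> poly_grade a \<and> c a = p g"
        by (auto simp: PiE_iff image_iff Bex_def)
      then obtain g where g: "\<And>a. g a \<in> poly_grade a" "\<And>a. c a = p (g a)"
        by metis
      let ?A = "{a\<in>UNIV. c a \<noteq> \<zero>\<^bsub>Q\<^esub>}"
      have "p f = finsum Q c ?A" using c f by simp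
      also have "\<dots> = p (sum g ?A)"
        by (simp only: p_sum[symmetric] g(2)[symmetric])
      finally have "f - sum g ?A \<in> I" by (simp only: p_eq)
      then have mem: "hcomp b f - hcomp b (sum g ?A) \<in> I" for b
        unfolding hcomp_diff[symmetric] by (rule monomial_ideal_hcomp[OF mon])
      show "c = (\<lambda>a. p (hcomp a f))"
      proof
        fix b
        have "hcomp b (sum g ?A) = (\<Sum>a\<in>?A. if b = a then g a else 0)"
          unfolding hcomp_sum by (rule sum.cong) (auto simp: hcomp_same[OF g(1)])
        also have "\<dots> = (if b \<in> ?A then g b else 0)"
          using c by (subst sum.delta') auto
        finally have "p (hcomp b f) = p (if b \<in> ?A then g b else 0)"
          using mem[of b] by (simp only: p_eq)
        also have "\<dots> = c b"
          using p_0 g(2) by auto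
        finally show "c b = p (hcomp b f)" ..
      qed
    qed
  qed
  have mul: "f \<odot>\<^bsub>quotient_module I\<^esub> x \<in> p ` poly_grade (\<lambda>i. a i + b i)"
    if "f \<in> poly_grade a" "x \<in> p ` poly_grade b" for f x a b
    using that poly_grade_mult[of f a _ b] by (auto simp: simps p_mult[symmetric])
  have grade: "grade (quotient_module I) = (\<lambda>a. p ` poly_grade a)"
    by (simp add: fun_eq_iff simps)
  have sum: "is_direct_sum (quotient_module I) UNIV (grade (quotient_module I))"
    unfolding is_direct_sum_def grade simps(1,2) finsum_quotient_module[of I, folded Q_def]
    by (intro conjI ballI) (rule sub, erule dec)
  show ?thesis
    unfolding multigraded_module_def
    by (intro conjI allI ballI) (use module_axioms sum mul in \<open>simp_all only: grade\<close>)
qed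

end

theory Submission
  imports Defs "HOL-Library.Cardinality"
begin

text \<open>
  A homogeneous nonzero element of \<open>I\<close> or of \<open>S/I\<close> is a scalar times a monomial \<open>x\<^sup>t\<close>, and
  \<open>x\<^sup>tK[Z]\<close> is free iff all of \<open>t + \<nat>\<^sup>Z\<close> consists of exponents of monomials of the module. So a
  Stanley decomposition is a finite partition of that set of exponents into blocks \<open>t + \<nat>\<^sup>Z\<close>.
  Let \<open>v = x\<^sup>w\<close>, and let \<open>E\<close> be the exponents of \<open>I'\<close>, so that those of \<open>I\<close> are \<open>w + E\<close>.
  Translating by \<open>w\<close> gives (2). For (1), the preimage under translation by \<open>w\<close> of a block is empty
  or a block with the same \<open>Z\<close>, so partitions of the complement of \<open>w + E\<close> restrict to partitions
  of the complement of \<open>E\<close>. Conversely, the complement of \<open>w + E\<close> is the translated complement of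
  \<open>E\<close> together with the non-multiples of \<open>x\<^sup>w\<close>, which split into blocks with \<open>|Z| = n - 1\<close>; this
  does not lower the depth, since a block with \<open>|Z| = n\<close> cannot avoid the nonempty set \<open>E\<close>.
\<close>

section \<open>Block partitions of sets of exponents\<close>

definition block :: "('n \<Rightarrow>\<^sub>0 nat) \<Rightarrow> 'n set \<Rightarrow> ('n \<Rightarrow>\<^sub>0 nat) set" where
  "block t Z = {t + s |s. Poly_Mapping.keys s \<subseteq> Z}"

definition block_partition :: "('n \<Rightarrow>\<^sub>0 nat) set \<Rightarrow> (('n \<Rightarrow>\<^sub>0 nat) \<times> 'n set) set \<Rightarrow> bool" where
  "block_partition C P \<longleftrightarrow> finite P \<and> (\<Union>(t, Z)\<in>P. block t Z) = C \<and>
     disjoint_family_on (\<lambda>(t, Z). block t Z) P"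

text \<open>A lower bound stands in for the depth itself: it passes to smaller \<open>d\<close>, so
  two partitions can be combined at a common bound. For empty \<open>C\<close> the empty partition
  satisfies it for every \<open>d\<close>.\<close>

definition block_depth_ge :: "('n \<Rightarrow>\<^sub>0 nat) set \<Rightarrow> nat \<Rightarrow> bool" where
  "block_depth_ge C d \<longleftrightarrow> (\<exists>P. block_partition C P \<and> (\<forall>(t, Z)\<in>P. d \<le> card Z))"

lemma mem_block_iff:
  "u \<in> block t Z \<longleftrightarrow> (\<forall>i. Poly_Mapping.lookup t i \<le> Poly_Mapping.lookup u i \<and>
     (i \<notin> Z \<longrightarrow> Poly_Mapping.lookup u i = Poly_Mapping.lookup t i))"
proof
  assume "u \<in> block t Z"
  then show "\<forall>i. Poly_Mapping.lookup t i \<le> Poly_Mapping.lookup u i \<and>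
     (i \<notin> Z \<longrightarrow> Poly_Mapping.lookup u i = Poly_Mapping.lookup t i)"
    by (auto simp: block_def lookup_add in_keys_iff subset_iff)
next
  assume *: "\<forall>i. Poly_Mapping.lookup t i \<le> Poly_Mapping.lookup u i \<and>
     (i \<notin> Z \<longrightarrow> Poly_Mapping.lookup u i = Poly_Mapping.lookup t i)"
  \<comment> \<open>Subtraction of exponents is truncated; it is exact here because \<open>t\<close>
    lies below \<open>u\<close> in each coordinate.\<close>
  then have "u = t + (u - t)"
    by (intro poly_mapping_eqI) (simp add: lookup_add lookup_minus)
  moreover have "Poly_Mapping.keys (u - t) \<subseteq> Z"
  proof
    fix i assume "i \<in> Poly_Mapping.keys (u - t)"
    then have "Poly_Mapping.lookup u i \<noteq> Poly_Mapping.lookup t i"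
      by (auto simp: in_keys_iff lookup_minus)
    then show "i \<in> Z"
      using * by blast
  qed
  ultimately show "u \<in> block t Z"
    unfolding block_def by blast
qed

lemma block_self: "t \<in> block t Z"
  by (simp add: mem_block_iff)

lemma add_mem_block: "Poly_Mapping.keys s \<subseteq> Z \<Longrightarrow> t + s \<in> block t Z"
  by (auto simp: block_def)

text \<open>Disjointness is unpacked pointwise, since the constructions below argue about a point
  shared by two blocks of an image or a union.\<close>

lemma block_depth_geE:
  assumes "block_depth_ge C d"
  obtains P where "finite P" "C = (\<Union>(t, Z)\<in>P. block t Z)"
    "\<And>t Z. (t, Z) \<in> P \<Longrightarrow> d \<le> card Z"
    "\<And>t Z t' Z' u. (t, Z) \<in> P \<Longrightarrow> (t', Z') \<in> P \<Longrightarrow> u \<in> block t Z \<Longrightarrow> u \<in> block t' Z' \<Longrightarrow>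
       t = t' \<and> Z = Z'"
proof -
  obtain P where P: "block_partition C P" "\<forall>(t, Z)\<in>P. d \<le> card Z"
    using assms unfolding block_depth_ge_def by blast
  show thesis
  proof (rule that[of P])
    fix t Z t' Z' u
    assume *: "(t, Z) \<in> P" "(t', Z') \<in> P" "u \<in> block t Z" "u \<in> block t' Z'"
    have "(t, Z) = (t', Z')"
    proof (rule ccontr)
      assume "(t, Z) \<noteq> (t', Z')"
      then have "block t Z \<inter> block t' Z' = {}"
        using P(1) disjoint_family_onD[of _ P "(t, Z)" "(t', Z')"] *(1,2)
        by (fastforce simp: block_partition_def)
      then show False
        using * by blast
    qed
    then show "t = t' \<and> Z = Z'"
      by simp
  qed (use P in \<open>auto simp: block_partition_def\<close>)
qed

lemma block_depth_geI:
  assumes "finite P" "C = (\<Union>(t, Z)\<in>P. block t Z)"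
    "\<And>t Z. (t, Z) \<in> P \<Longrightarrow> d \<le> card Z"
    "\<And>t Z t' Z' u. (t, Z) \<in> P \<Longrightarrow> (t', Z') \<in> P \<Longrightarrow> u \<in> block t Z \<Longrightarrow> u \<in> block t' Z' \<Longrightarrow>
       t = t' \<and> Z = Z'"
  shows "block_depth_ge C d"
proof -
  have "disjoint_family_on (\<lambda>(t, Z). block t Z) P"
    unfolding disjoint_family_on_def using assms(4) by fast
  then show ?thesis
    unfolding block_depth_ge_def block_partition_def using assms(1-3) by blast
qed

lemma block_depth_ge_mono: "block_depth_ge C d \<Longrightarrow> e \<le> d \<Longrightarrow> block_depth_ge C e"
  unfolding block_depth_ge_def by fastforce

text \<open>A nonempty \<open>C\<close> needs at least one block, and a direction set has at most n
  elements. Hence only finitely many \<open>d\<close> are admissible, which gives meaning to their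
  \<open>Max\<close>.\<close>

lemma block_depth_ge_le_card:
  fixes C :: "('n::finite \<Rightarrow>\<^sub>0 nat) set"
  assumes "block_depth_ge C d" "C \<noteq> {}"
  shows "d \<le> CARD('n)"
proof -
  obtain t Z where "(t :: 'n \<Rightarrow>\<^sub>0 nat, Z :: 'n set) \<in> {p. d \<le> card (snd p)}"
    using assms by (auto elim!: block_depth_geE)
  moreover have "card Z \<le> CARD('n)"
    by (simp add: card_mono)
  ultimately show ?thesis by simp
qed

section \<open>Disjoint unions, translates and preimages of block partitions\<close>

lemma block_depth_ge_Un:
  assumes "block_depth_ge C d" "block_depth_ge C' d" "C \<inter> C' = {}"
  shows "block_depth_ge (C \<union> C') d"
proof -
  from assms(1) obtain P where P: "finite P" "C = (\<Union>(t, Z)\<in>P. block t Z)"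
    "\<And>t Z. (t, Z) \<in> P \<Longrightarrow> d \<le> card Z"
    "\<And>t Z t' Z' u. (t, Z) \<in> P \<Longrightarrow> (t', Z') \<in> P \<Longrightarrow> u \<in> block t Z \<Longrightarrow> u \<in> block t' Z' \<Longrightarrow>
       t = t' \<and> Z = Z'"
    by (rule block_depth_geE) blast
  from assms(2) obtain P' where P': "finite P'" "C' = (\<Union>(t, Z)\<in>P'. block t Z)"
    "\<And>t Z. (t, Z) \<in> P' \<Longrightarrow> d \<le> card Z"
    "\<And>t Z t' Z' u. (t, Z) \<in> P' \<Longrightarrow> (t', Z') \<in> P' \<Longrightarrow> u \<in> block t Z \<Longrightarrow> u \<in> block t' Z' \<Longrightarrow>
       t = t' \<and> Z = Z'"
    by (rule block_depth_geE) blast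
  have in_C: "u \<in> C" if "(t, Z) \<in> P" "u \<in> block t Z" for u t Z
    using that P(2) by blast
  have in_C': "u \<in> C'" if "(t, Z) \<in> P'" "u \<in> block t Z" for u t Z
    using that P'(2) by blast
  show ?thesis
  proof (rule block_depth_geI[of "P \<union> P'"])
    show "C \<union> C' = (\<Union>(t, Z)\<in>P \<union> P'. block t Z)"
      unfolding P(2) P'(2) by blast
    fix t Z t' Z' u
    assume u: "(t, Z) \<in> P \<union> P'" "(t', Z') \<in> P \<union> P'" "u \<in> block t Z" "u \<in> block t' Z'"
    \<comment> \<open>A shared point lies in only one of \<open>C\<close> and \<open>C'\<close>, so
      both of its blocks come from the same partition.\<close>
    have "\<not> (u \<in> C \<and> u \<in> C')"
      using assms(3) by blast
    with u(1,2) show "t = t' \<and> Z = Z'"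
      using in_C[OF _ u(3)] in_C[OF _ u(4)] in_C'[OF _ u(3)] in_C'[OF _ u(4)]
        P(4)[OF _ _ u(3,4)] P'(4)[OF _ _ u(3,4)] by blast
  qed (use P P' in auto)
qed

lemma block_add: "block (w + t) Z = (+) w ` block t Z"
  by (auto simp: block_def image_iff add.assoc)

text \<open>Translation by \<open>w\<close> is injective and sends a block to a block with the same
  \<open>Z\<close>.\<close>

lemma block_depth_ge_translate:
  assumes "block_depth_ge C d"
  shows "block_depth_ge ((+) w ` C) d"
proof -
  from assms obtain P where P: "finite P" "C = (\<Union>(t, Z)\<in>P. block t Z)"
    "\<And>t Z. (t, Z) \<in> P \<Longrightarrow> d \<le> card Z"
    "\<And>t Z t' Z' u. (t, Z) \<in> P \<Longrightarrow> (t', Z') \<in> P \<Longrightarrow> u \<in> block t Z \<Longrightarrow> u \<in> block t' Z' \<Longrightarrow>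
       t = t' \<and> Z = Z'"
    by (rule block_depth_geE) blast
  show ?thesis
  proof (rule block_depth_geI[of "(\<lambda>(t, Z). (w + t, Z)) ` P"])
    show "(+) w ` C = (\<Union>(t, Z)\<in>(\<lambda>(t, Z). (w + t, Z)) ` P. block t Z)"
      unfolding P(2) image_UN by (simp add: block_add case_prod_unfold)
    fix t Z t' Z' u
    assume "(t, Z) \<in> (\<lambda>(t, Z). (w + t, Z)) ` P" "(t', Z') \<in> (\<lambda>(t, Z). (w + t, Z)) ` P"
      "u \<in> block t Z" "u \<in> block t' Z'"
    then show "t = t' \<and> Z = Z'"
      using P(4) by (fastforce simp: block_add)
  qed (use P in auto)
qed

text \<open>Outside \<open>Z\<close> the hypothesis forces \<open>w\<close> to lie below
  \<open>t\<close>, so \<open>t - w\<close> is exact there. In the directions of \<open>Z\<close>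
  only a lower bound is imposed, and truncation at 0 gives the right one.\<close>

lemma vimage_add_block:
  assumes "w + u \<in> block t Z"
  shows "(+) w -` block t Z = block (t - w) Z"
proof -
  have "Poly_Mapping.lookup w i \<le> Poly_Mapping.lookup t i" if "i \<notin> Z" for i
    using assms that by (auto simp: mem_block_iff lookup_add)
  then have "Poly_Mapping.lookup t i \<le> Poly_Mapping.lookup w i + Poly_Mapping.lookup u' i \<and>
      (i \<notin> Z \<longrightarrow> Poly_Mapping.lookup w i + Poly_Mapping.lookup u' i = Poly_Mapping.lookup t i) \<longleftrightarrow>
      Poly_Mapping.lookup t i - Poly_Mapping.lookup w i \<le> Poly_Mapping.lookup u' i \<and>
      (i \<notin> Z \<longrightarrow> Poly_Mapping.lookup u' i = Poly_Mapping.lookup t i - Poly_Mapping.lookup w i)"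
    for u' i
    by (cases "i \<in> Z") fastforce+
  then show ?thesis
    by (simp add: set_eq_iff mem_block_iff lookup_add lookup_minus)
qed

lemma block_depth_ge_vimage:
  assumes "block_depth_ge C d"
  shows "block_depth_ge ((+) w -` C) d"
proof -
  from assms obtain P where P: "finite P" "C = (\<Union>(t, Z)\<in>P. block t Z)"
    "\<And>t Z. (t, Z) \<in> P \<Longrightarrow> d \<le> card Z"
    "\<And>t Z t' Z' u. (t, Z) \<in> P \<Longrightarrow> (t', Z') \<in> P \<Longrightarrow> u \<in> block t Z \<Longrightarrow> u \<in> block t' Z' \<Longrightarrow>
       t = t' \<and> Z = Z'"
    by (rule block_depth_geE) blast
  \<comment> \<open>Blocks that contain no multiple of \<open>w\<close> have empty preimage and are
    dropped.\<close>
  define Q where "Q = {(t, Z) \<in> P. \<exists>u. w + u \<in> block t Z}"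
  have Q: "(t, Z) \<in> P" "(+) w -` block t Z = block (t - w) Z" if "(t, Z) \<in> Q" for t Z
    using that vimage_add_block[of w _ t Z] unfolding Q_def by blast+
  show ?thesis
  proof (rule block_depth_geI[of "(\<lambda>(t, Z). (t - w, Z)) ` Q"])
    have "finite Q"
      using P(1) by (rule rev_finite_subset) (auto simp: Q_def)
    then show "finite ((\<lambda>(t, Z). (t - w, Z)) ` Q)"
      by simp
    have "(+) w -` C = (\<Union>(t, Z)\<in>Q. (+) w -` block t Z)"
      unfolding P(2) Q_def by auto
    also have "\<dots> = (\<Union>(t, Z)\<in>Q. block (t - w) Z)"
      using Q(2) by (intro SUP_cong) auto
    finally show "(+) w -` C = (\<Union>(t, Z)\<in>(\<lambda>(t, Z). (t - w, Z)) ` Q. block t Z)"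
      by (simp add: case_prod_unfold)
    show "d \<le> card Z" if "(t, Z) \<in> (\<lambda>(t, Z). (t - w, Z)) ` Q" for t Z
      using that P(3) Q(1) by auto
    fix t Z t' Z' u
    assume "(t, Z) \<in> (\<lambda>(t, Z). (t - w, Z)) ` Q" "(t', Z') \<in> (\<lambda>(t, Z). (t - w, Z)) ` Q"
      and u: "u \<in> block t Z" "u \<in> block t' Z'"
    then obtain s s' where s: "(s, Z) \<in> Q" "t = s - w" "(s', Z') \<in> Q" "t' = s' - w"
      by auto
    \<comment> \<open>A point shared by two preimages lifts to \<open>w + u\<close>, shared by the
      original blocks, so disjointness in \<open>P\<close> applies.\<close>
    then have "w + u \<in> block s Z" "w + u \<in> block s' Z'"
      using u Q(2) by auto
    then show "t = t' \<and> Z = Z'"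
      using P(4) Q(1) s by metis
  qed
qed

section \<open>Partitioning the non-multiples of a fixed exponent\<close>

lemma sum_single_lookup:
  "(\<Sum>t \<in> Poly_Mapping.keys f. Poly_Mapping.single t (Poly_Mapping.lookup f t)) = f"
proof (rule poly_mapping_eqI)
  fix s
  have "Poly_Mapping.lookup (\<Sum>t \<in> Poly_Mapping.keys f. Poly_Mapping.single t (Poly_Mapping.lookup f t)) s
      = (\<Sum>t \<in> Poly_Mapping.keys f. if t = s then Poly_Mapping.lookup f s else 0)"
    unfolding lookup_sum by (rule sum.cong) (auto simp: lookup_single when_def)
  also have "\<dots> = Poly_Mapping.lookup f s"
    by (subst sum.delta) (auto simp: in_keys_iff)
  finally show "Poly_Mapping.lookup (\<Sum>t \<in> Poly_Mapping.keys f.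
      Poly_Mapping.single t (Poly_Mapping.lookup f t)) s = Poly_Mapping.lookup f s" .
qed

text \<open>Splitting off the multiples of \<open>w\<close> from the non-multiples of \<open>w + w'\<close> makes the property
  additive in \<open>w\<close>, and the exponents not divisible by a variable form a single block.\<close>

lemma block_depth_ge_not_multiple:
  fixes w :: "'n::finite \<Rightarrow>\<^sub>0 nat"
  shows "block_depth_ge (- range ((+) w)) (CARD('n) - 1)"
proof -
  define Q where "Q w = block_depth_ge (- range ((+) w)) (CARD('n) - 1)" for w :: "'n \<Rightarrow>\<^sub>0 nat"
  have zero: "Q 0"
  proof -
    \<comment> \<open>Every exponent is a multiple of 0, so the set to be partitioned is
      empty.\<close>
    have "range ((+) (0 :: 'n \<Rightarrow>\<^sub>0 nat)) = UNIV"
      by auto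
    then show ?thesis
      unfolding Q_def by (intro block_depth_geI[of "{}"]) auto
  qed
  have add: "Q (w + w')" if "Q w" "Q w'" for w w'
  proof -
    have "- range ((+) (w + w')) = - range ((+) w) \<union> (+) w ` (- range ((+) w'))"
      by (auto simp: image_iff add.assoc)
    moreover have "- range ((+) w) \<inter> (+) w ` (- range ((+) w')) = {}"
      by auto
    ultimately show ?thesis
      using that block_depth_ge_Un[OF _ block_depth_ge_translate] unfolding Q_def by metis
  qed
  have one: "Q (Poly_Mapping.single i 1)" for i
    unfolding Q_def
  proof (rule block_depth_geI[of "{(0, - {i})}"])
    have "u \<in> range ((+) (Poly_Mapping.single i 1)) \<longleftrightarrow> u \<notin> block 0 (- {i})" for u :: "'n \<Rightarrow>\<^sub>0 nat"
    proof
      assume "u \<notin> block 0 (- {i})"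
      then have "0 < Poly_Mapping.lookup u i"
        by (auto simp: mem_block_iff)
      then have "u = Poly_Mapping.single i 1 + (u - Poly_Mapping.single i 1)"
        by (intro poly_mapping_eqI) (auto simp: lookup_add lookup_minus lookup_single when_def)
      then show "u \<in> range ((+) (Poly_Mapping.single i 1))"
        by blast
    qed (auto simp: mem_block_iff lookup_add lookup_single)
    then show "- range ((+) (Poly_Mapping.single i 1)) = (\<Union>(t, Z)\<in>{(0, - {i})}. block t Z)"
      by auto
  qed (auto simp: Compl_eq_Diff_UNIV)
  have single: "Q (Poly_Mapping.single i k)" for i k
  proof (induction k)
    case (Suc k)
    then show ?case
      using add[OF one[of i] Suc] by (simp add: single_add[symmetric])
  qed (unfold single_zero, rule zero)
  have "Q (\<Sum>i\<in>A. Poly_Mapping.single i (f i))" for A and f :: "'n \<Rightarrow> nat"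
    by (induction A rule: infinite_finite_induct) (auto simp: zero single intro: add)
  \<comment> \<open>\<open>w\<close> is the sum of its one-coordinate parts.\<close>
  from this[of "Poly_Mapping.lookup w" "Poly_Mapping.keys w"] show ?thesis
    by (simp add: sum_single_lookup Q_def)
qed


section \<open>Free cyclic modules and direct sums\<close>

lemma ex1_unique: "\<exists>!x. P x \<Longrightarrow> P a \<Longrightarrow> P b \<Longrightarrow> a = b"
  by blast

text \<open>The basis \<open>B\<close> supplied by freeness need not be \<open>{m}\<close>. But any
  \<open>b\<close> in \<open>B\<close> is a multiple of \<open>m\<close>, so by commutativity
  \<open>f\<close> kills \<open>b\<close> as well; a nonzero \<open>f\<close> would then be the
  coefficient of a second expansion of zero.\<close>

lemma free_module_cyclic_cancel:
  assumes free: "free_module R M" and gen: "carrier M \<subseteq> {g \<odot>\<^bsub>M\<^esub> m |g. g \<in> carrier R}"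
    and m: "m \<in> carrier M" "m \<noteq> \<zero>\<^bsub>M\<^esub>" and f: "f \<in> carrier R" "f \<odot>\<^bsub>M\<^esub> m = \<zero>\<^bsub>M\<^esub>"
  shows "f = \<zero>\<^bsub>R\<^esub>"
proof (rule ccontr)
  assume nz: "f \<noteq> \<zero>\<^bsub>R\<^esub>"
  interpret module R M
    using free by (simp add: free_module_def)
  obtain B where B: "B \<subseteq> carrier M" "\<forall>x\<in>carrier M. \<exists>!c. c \<in> (B \<rightarrow>\<^sub>E carrier R) \<and>
        finite {b\<in>B. c b \<noteq> \<zero>\<^bsub>R\<^esub>} \<and>
        x = (\<Oplus>\<^bsub>M\<^esub> b \<in> {b\<in>B. c b \<noteq> \<zero>\<^bsub>R\<^esub>}. c b \<odot>\<^bsub>M\<^esub> b)"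
    using free unfolding free_module_def by (elim conjE exE) (rule that)
  note uniq = B(2)[rule_format]
  have "B \<noteq> {}"
    using uniq[OF m(1)] m(2) by auto
  then obtain b where b: "b \<in> B" by blast
  then obtain g where g: "g \<in> carrier R" "b = g \<odot>\<^bsub>M\<^esub> m"
    using B(1) gen by blast
  have "f \<odot>\<^bsub>M\<^esub> b = g \<odot>\<^bsub>M\<^esub> (f \<odot>\<^bsub>M\<^esub> m)"
    using f(1) g m(1) by (simp add: smult_assoc1[symmetric] R.m_comm)
  then have fb: "f \<odot>\<^bsub>M\<^esub> b = \<zero>\<^bsub>M\<^esub>"
    using f(2) g(1) by simp
  \<comment> \<open>The zero family and the family with single entry \<open>f\<close> at
    \<open>b\<close> both expand zero.\<close>
  define c0 where "c0 = (\<lambda>b\<in>B. \<zero>\<^bsub>R\<^esub>)"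
  define c1 where "c1 = c0(b := f)"
  have supp0: "{b\<in>B. c0 b \<noteq> \<zero>\<^bsub>R\<^esub>} = {}"
    by (auto simp: c0_def)
  have supp1: "{b\<in>B. c1 b \<noteq> \<zero>\<^bsub>R\<^esub>} = {b}"
    using nz b by (auto simp: c1_def c0_def)
  have "c0 \<in> B \<rightarrow>\<^sub>E carrier R" "c1 \<in> B \<rightarrow>\<^sub>E carrier R"
    using f(1) b by (auto simp: c0_def c1_def PiE_iff extensional_def)
  moreover have "(\<Oplus>\<^bsub>M\<^esub> b \<in> {b\<in>B. c1 b \<noteq> \<zero>\<^bsub>R\<^esub>}. c1 b \<odot>\<^bsub>M\<^esub> b) = \<zero>\<^bsub>M\<^esub>"
    unfolding supp1 using fb by (simp add: c1_def)
  moreover have "(\<Oplus>\<^bsub>M\<^esub> b \<in> {b\<in>B. c0 b \<noteq> \<zero>\<^bsub>R\<^esub>}. c0 b \<odot>\<^bsub>M\<^esub> b) = \<zero>\<^bsub>M\<^esub>"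
    unfolding supp0 by simp
  ultimately have "c0 = c1"
    by (intro ex1_unique[OF uniq[OF M.zero_closed]] conjI)
      (simp_all only: supp0 supp1 finite.emptyI finite.insertI)
  then show False
    using supp0 supp1 by simp
qed

text \<open>\<open>{m}\<close> is a basis: generation gives a coefficient, and the difference of two
  coefficients of the same element annihilates \<open>m\<close>.\<close>

lemma free_module_cyclicI:
  assumes "module R M" and gen: "carrier M \<subseteq> {g \<odot>\<^bsub>M\<^esub> m |g. g \<in> carrier R}"
    and m: "m \<in> carrier M" and ann: "\<And>f. f \<in> carrier R \<Longrightarrow> f \<odot>\<^bsub>M\<^esub> m = \<zero>\<^bsub>M\<^esub> \<Longrightarrow> f = \<zero>\<^bsub>R\<^esub>"
  shows "free_module R M"
proof -
  interpret module R M by fact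
  have sum: "(\<Oplus>\<^bsub>M\<^esub> b \<in> {b\<in>{m}. c b \<noteq> \<zero>\<^bsub>R\<^esub>}. c b \<odot>\<^bsub>M\<^esub> b) = c m \<odot>\<^bsub>M\<^esub> m"
    if "c \<in> {m} \<rightarrow>\<^sub>E carrier R" for c
  \<comment> \<open>The sum runs over the support of \<open>c\<close>, so it is empty when the
    coefficient at \<open>m\<close> vanishes.\<close>
  proof (cases "c m = \<zero>\<^bsub>R\<^esub>")
    case True
    then have "{b\<in>{m}. c b \<noteq> \<zero>\<^bsub>R\<^esub>} = {}" by auto
    then show ?thesis using True m by (simp only: M.finsum_empty smult_l_null)
  next
    case False
    then have "{b\<in>{m}. c b \<noteq> \<zero>\<^bsub>R\<^esub>} = {m}" by auto
    moreover have "c m \<in> carrier R" using that by auto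
    ultimately show ?thesis using m by simp
  qed
  have fin: "finite {b\<in>{m}. c b \<noteq> \<zero>\<^bsub>R\<^esub>}" for c :: "'c \<Rightarrow> 'a"
    by simp
  show ?thesis
    unfolding free_module_def
  proof (intro conjI exI[of _ "{m}"] ballI)
    show "module R M" by fact
    show "{m} \<subseteq> carrier M" using m by simp
    fix x assume "x \<in> carrier M"
    then obtain g where g: "g \<in> carrier R" "x = g \<odot>\<^bsub>M\<^esub> m"
      using gen by blast
    let ?c = "\<lambda>b\<in>{m}. g"
    have c: "?c \<in> {m} \<rightarrow>\<^sub>E carrier R" using g by auto
    show "\<exists>!c. c \<in> ({m} \<rightarrow>\<^sub>E carrier R) \<and> finite {b\<in>{m}. c b \<noteq> \<zero>\<^bsub>R\<^esub>} \<and>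
        x = (\<Oplus>\<^bsub>M\<^esub> b \<in> {b\<in>{m}. c b \<noteq> \<zero>\<^bsub>R\<^esub>}. c b \<odot>\<^bsub>M\<^esub> b)"
    proof (rule ex1I[of _ ?c], intro conjI)
      show "x = (\<Oplus>\<^bsub>M\<^esub> b \<in> {b\<in>{m}. ?c b \<noteq> \<zero>\<^bsub>R\<^esub>}. ?c b \<odot>\<^bsub>M\<^esub> b)"
        unfolding sum[OF c] using g by simp
      fix c assume *: "c \<in> ({m} \<rightarrow>\<^sub>E carrier R) \<and> finite {b\<in>{m}. c b \<noteq> \<zero>\<^bsub>R\<^esub>} \<and>
        x = (\<Oplus>\<^bsub>M\<^esub> b \<in> {b\<in>{m}. c b \<noteq> \<zero>\<^bsub>R\<^esub>}. c b \<odot>\<^bsub>M\<^esub> b)"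
      then have cm: "c m \<in> carrier R" "c m \<odot>\<^bsub>M\<^esub> m = g \<odot>\<^bsub>M\<^esub> m"
        using sum[of c] g(2) by auto
      have "(c m \<ominus>\<^bsub>R\<^esub> g) \<odot>\<^bsub>M\<^esub> m = \<zero>\<^bsub>M\<^esub>"
        using cm g(1) m
        by (simp add: a_minus_def smult_l_distr smult_l_minus M.r_neg)
      then have "c m \<ominus>\<^bsub>R\<^esub> g = \<zero>\<^bsub>R\<^esub>"
        using ann cm(1) g(1) by simp
      then have "c m = g"
        using cm(1) g(1) by simp
      then show "c = ?c"
        using * by (auto simp: PiE_iff extensional_def fun_eq_iff)
    qed (use c fin in auto)
  qed
qed


section \<open>Polynomials with prescribed exponents\<close>

text \<open>The linear projection onto the span of the monomials with exponent in \<open>C\<close>.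
  When \<open>C\<close> is the complement of the exponents of a monomial ideal, it computes normal
  forms modulo that ideal.\<close>

definition restrict_terms :: "('n \<Rightarrow>\<^sub>0 nat) set \<Rightarrow> ('n, 'k::field) mpoly \<Rightarrow> ('n, 'k) mpoly" where
  "restrict_terms C f =
     (\<Sum>t \<in> {t \<in> Poly_Mapping.keys f. t \<in> C}. Poly_Mapping.single t (Poly_Mapping.lookup f t))"

lemma lookup_restrict_terms:
  "Poly_Mapping.lookup (restrict_terms C f) t = (if t \<in> C then Poly_Mapping.lookup f t else 0)"
proof -
  have "Poly_Mapping.lookup (restrict_terms C f) t = (\<Sum>s \<in> {s \<in> Poly_Mapping.keys f. s \<in> C}.
      if s = t then Poly_Mapping.lookup f t else 0)"
    unfolding restrict_terms_def lookup_sum by (rule sum.cong) (auto simp: lookup_single when_def)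
  also have "\<dots> = (if t \<in> C then Poly_Mapping.lookup f t else 0)"
    by (subst sum.delta) (auto simp: in_keys_iff)
  finally show ?thesis .
qed

lemma keys_restrict_terms: "Poly_Mapping.keys (restrict_terms C f) = Poly_Mapping.keys f \<inter> C"
  by (auto simp: in_keys_iff lookup_restrict_terms split: if_splits)

lemma restrict_terms_same: "Poly_Mapping.keys f \<subseteq> C \<Longrightarrow> restrict_terms C f = f"
  by (rule poly_mapping_eqI) (auto simp: lookup_restrict_terms in_keys_iff)

lemma restrict_terms_disjoint: "Poly_Mapping.keys f \<inter> C = {} \<Longrightarrow> restrict_terms C f = 0"
  by (rule poly_mapping_eqI) (auto simp: lookup_restrict_terms in_keys_iff)

lemma restrict_terms_add: "restrict_terms C (f + g) = restrict_terms C f + restrict_terms C g"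
  by (rule poly_mapping_eqI) (simp add: lookup_restrict_terms lookup_add)

lemma restrict_terms_diff: "restrict_terms C (f - g) = restrict_terms C f - restrict_terms C g"
  by (rule poly_mapping_eqI) (simp add: lookup_restrict_terms lookup_minus)

lemma restrict_terms_sum: "restrict_terms C (sum h J) = (\<Sum>j\<in>J. restrict_terms C (h j))"
  by (rule poly_mapping_eqI) (simp add: lookup_restrict_terms lookup_sum)

section \<open>Multiplication by a single term\<close>

lemma mult_single_expand:
  fixes f :: "('n, 'k::field) mpoly"
  shows "f * Poly_Mapping.single t c =
    (\<Sum>s \<in> Poly_Mapping.keys f. Poly_Mapping.single (s + t) (Poly_Mapping.lookup f s * c))"
  by (subst (1) sum_single_lookup[symmetric]) (simp add: sum_distrib_right mult_single)

lemma lookup_mult_single: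
  fixes f :: "('n, 'k::field) mpoly"
  shows "Poly_Mapping.lookup (f * Poly_Mapping.single t c) (s + t) = Poly_Mapping.lookup f s * c"
proof -
  have "Poly_Mapping.lookup (f * Poly_Mapping.single t c) (s + t) =
      (\<Sum>r \<in> Poly_Mapping.keys f. if r = s then Poly_Mapping.lookup f s * c else 0)"
    unfolding mult_single_expand lookup_sum
    by (rule sum.cong) (auto simp: lookup_single when_def)
  also have "\<dots> = Poly_Mapping.lookup f s * c"
    by (subst sum.delta) (auto simp: in_keys_iff)
  finally show ?thesis .
qed

text \<open>Distinct \<open>s\<close> give distinct \<open>s + t\<close>, and coefficients are
  scaled by a nonzero \<open>c\<close>, so nothing merges or cancels.\<close>

lemma keys_mult_single:
  fixes f :: "('n, 'k::field) mpoly"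
  assumes "c \<noteq> 0"
  shows "Poly_Mapping.keys (f * Poly_Mapping.single t c) = (\<lambda>s. s + t) ` Poly_Mapping.keys f"
proof
  show "(\<lambda>s. s + t) ` Poly_Mapping.keys f \<subseteq> Poly_Mapping.keys (f * Poly_Mapping.single t c)"
    using assms by (auto simp: in_keys_iff lookup_mult_single)
  show "Poly_Mapping.keys (f * Poly_Mapping.single t c) \<subseteq> (\<lambda>s. s + t) ` Poly_Mapping.keys f"
    using keys_mult[of f "Poly_Mapping.single t c"] assms by auto
qed

section \<open>The subalgebras \<open>K[Z]\<close>\<close>

lemma vars_subalgebra_simps [simp]:
  "f \<in> carrier (vars_subalgebra Z) \<longleftrightarrow> (\<forall>t \<in> Poly_Mapping.keys f. Poly_Mapping.keys t \<subseteq> Z)"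
  "x \<otimes>\<^bsub>vars_subalgebra Z\<^esub> y = x * y" "\<one>\<^bsub>vars_subalgebra Z\<^esub> = 1"
  "\<zero>\<^bsub>vars_subalgebra Z\<^esub> = 0" "x \<oplus>\<^bsub>vars_subalgebra Z\<^esub> y = x + y"
  by (simp_all add: vars_subalgebra_def)

lemma vars_subalgebra_closed:
  "0 \<in> carrier (vars_subalgebra Z)" "1 \<in> carrier (vars_subalgebra Z)"
  "f \<in> carrier (vars_subalgebra Z) \<Longrightarrow> g \<in> carrier (vars_subalgebra Z) \<Longrightarrow>
     f + g \<in> carrier (vars_subalgebra Z)"
  "f \<in> carrier (vars_subalgebra Z) \<Longrightarrow> g \<in> carrier (vars_subalgebra Z) \<Longrightarrow>
     f * g \<in> carrier (vars_subalgebra Z)"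
  "f \<in> carrier (vars_subalgebra Z) \<Longrightarrow> - f \<in> carrier (vars_subalgebra Z)"
proof -
  show "f * g \<in> carrier (vars_subalgebra Z)"
    if fg: "f \<in> carrier (vars_subalgebra Z)" "g \<in> carrier (vars_subalgebra Z)"
    unfolding vars_subalgebra_simps
  proof
    fix t assume "t \<in> Poly_Mapping.keys (f * g)"
    then obtain r s where "t = r + s" "r \<in> Poly_Mapping.keys f" "s \<in> Poly_Mapping.keys g"
      using keys_mult[of f g] by blast
    moreover from this have "Poly_Mapping.keys r \<subseteq> Z" "Poly_Mapping.keys s \<subseteq> Z"
      using fg by auto
    ultimately show "Poly_Mapping.keys t \<subseteq> Z"
      using keys_add[of r s] by blast
  qed
qed (use keys_add[of f g] in \<open>auto simp: in_keys_iff lookup_one when_def\<close>)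

lemma cring_vars_subalgebra: "cring (vars_subalgebra Z :: ('n, 'k::field) mpoly ring)"
proof (rule cringI)
  note closed = vars_subalgebra_closed[where Z = Z]
  show "abelian_group (vars_subalgebra Z :: ('n, 'k) mpoly ring)"
  proof (rule abelian_groupI)
    fix x :: "('n, 'k) mpoly" assume "x \<in> carrier (vars_subalgebra Z)"
    then show "\<exists>y\<in>carrier (vars_subalgebra Z). y \<oplus>\<^bsub>vars_subalgebra Z\<^esub> x = \<zero>\<^bsub>vars_subalgebra Z\<^esub>"
      by (intro bexI[of _ "- x"] closed) simp
  qed (simp_all add: closed algebra_simps del: vars_subalgebra_simps(1))
  show "comm_monoid (vars_subalgebra Z :: ('n, 'k) mpoly ring)"
    by (rule comm_monoidI) (simp_all add: closed algebra_simps del: vars_subalgebra_simps(1))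
qed (simp add: algebra_simps)

text \<open>Placing \<open>x\<close> at index \<open>i\<close>, or at index \<open>j\<close>, with
  zeros elsewhere gives two expansions of \<open>x\<close>; uniqueness identifies them, which is
  impossible for nonzero \<open>x\<close>.\<close>

lemma (in abelian_group) direct_sum_disjoint:
  assumes sum: "is_direct_sum G J N" and ij: "i \<in> J" "j \<in> J" "i \<noteq> j" and x: "x \<in> N i" "x \<in> N j"
  shows "x = \<zero>"
proof (rule ccontr)
  assume nz: "x \<noteq> \<zero>"
  have sub: "additive_subgroup (N k) G" if "k \<in> J" for k
    using sum that unfolding is_direct_sum_def by simp
  have xG: "x \<in> carrier G"
    using additive_subgroup.a_Hcarr[OF sub[OF ij(1)] x(1)] .
  define c where "c k = (\<lambda>l\<in>J. if l = k then x else \<zero>)" for k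
  have supp: "{l\<in>J. c k l \<noteq> \<zero>} = {k}" if "k \<in> J" for k
    using that nz by (auto simp: c_def)
  have sumc: "x = (\<Oplus> l \<in> {l\<in>J. c k l \<noteq> \<zero>}. c k l)" if "k \<in> J" for k
    unfolding supp[OF that] using that xG by (simp add: c_def)
  have mem: "c k \<in> (\<Pi>\<^sub>E j\<in>J. N j)" if "k \<in> {i, j}" for k
    using that x ij additive_subgroup.zero_closed[OF sub] by (auto simp: c_def)
  have "\<exists>!c. c \<in> (\<Pi>\<^sub>E j\<in>J. N j) \<and> finite {j\<in>J. c j \<noteq> \<zero>} \<and> x = (\<Oplus> j \<in> {j\<in>J. c j \<noteq> \<zero>}. c j)"
    using sum xG unfolding is_direct_sum_def by simp
  then have "c i = c j"
  proof (rule ex1_unique)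
    show "c i \<in> (\<Pi>\<^sub>E j\<in>J. N j) \<and> finite {j\<in>J. c i j \<noteq> \<zero>} \<and>
        x = (\<Oplus> j \<in> {j\<in>J. c i j \<noteq> \<zero>}. c i j)"
      using mem[of i] sumc[OF ij(1)] supp[OF ij(1)] by simp
    show "c j \<in> (\<Pi>\<^sub>E j\<in>J. N j) \<and> finite {k\<in>J. c j k \<noteq> \<zero>} \<and>
        x = (\<Oplus> k \<in> {k\<in>J. c j k \<noteq> \<zero>}. c j k)"
      using mem[of j] sumc[OF ij(2)] supp[OF ij(2)] by simp
  qed
  then have "c i i = c j i" by simp
  then show False
    using nz ij by (simp add: c_def)
qed

lemma degree_vec_inject: "degree_vec s = degree_vec t \<longleftrightarrow> s = t"
  by (auto simp: degree_vec_def fun_eq_iff intro: poly_mapping_eqI)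

lemma single_nonzero: "c \<noteq> 0 \<Longrightarrow> Poly_Mapping.single t c \<noteq> 0"
  by (metis keys_single insert_not_empty keys_zero)

text \<open>The multidegree determines the exponent, so each graded piece of the polynomial ring is
  at most one-dimensional.\<close>

lemma poly_grade_nonzeroE:
  fixes f :: "('n, 'k::field) mpoly"
  assumes "f \<in> poly_grade a" "f \<noteq> 0"
  obtains t c where "c \<noteq> 0" "f = Poly_Mapping.single t c"
proof -
  obtain t where t: "t \<in> Poly_Mapping.keys f"
    using assms(2) by fastforce
  have "Poly_Mapping.keys f = {t}"
    using assms(1) t degree_vec_inject by (fastforce simp: poly_grade_eq)
  then have "f = Poly_Mapping.single t (Poly_Mapping.lookup f t)"
    using sum_single_lookup[of f] by simp
  then show thesis
    using that t by (auto simp: in_keys_iff)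
qed


section \<open>Stanley decompositions as block partitions\<close>

lemma sdepth_decomposition_eq: "sdepth_decomposition D = Min ((\<lambda>(m, Z). card Z) ` set D)"
  unfolding sdepth_decomposition_def by (rule arg_cong[of _ _ Min]) force

text \<open>Common model of a monomial ideal and of its quotient: as a vector space \<open>M\<close>
  has the monomials with exponent in \<open>C\<close> as a basis, and a polynomial acts by
  multiplication followed by deletion of the terms outside \<open>C\<close>. Both claims of the
  theorem are thus reduced to sets of exponents at once.\<close>

locale monomial_module = module polyring M
  for M :: "(('n::finite, 'k::field) mpoly, 'b, 'n) graded_module" +
  fixes C :: "('n \<Rightarrow>\<^sub>0 nat) set" and coord :: "'b \<Rightarrow> ('n, 'k) mpoly"
  assumes coord_bij: "bij_betw coord (carrier M) {f. Poly_Mapping.keys f \<subseteq> C}"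
    and coord_add: "x \<in> carrier M \<Longrightarrow> y \<in> carrier M \<Longrightarrow> coord (x \<oplus>\<^bsub>M\<^esub> y) = coord x + coord y"
    and coord_smult: "x \<in> carrier M \<Longrightarrow> coord (f \<odot>\<^bsub>M\<^esub> x) = restrict_terms C (f * coord x)"
    and grade_eq: "grade M a = {x \<in> carrier M. coord x \<in> poly_grade a}"
begin

lemma coord_keys: "x \<in> carrier M \<Longrightarrow> Poly_Mapping.keys (coord x) \<subseteq> C"
  using coord_bij by (auto simp: bij_betw_def)

lemma coord_inject: "x \<in> carrier M \<Longrightarrow> y \<in> carrier M \<Longrightarrow> coord x = coord y \<longleftrightarrow> x = y"
  using coord_bij by (auto simp: bij_betw_def inj_on_eq_iff)

definition elem :: "('n, 'k) mpoly \<Rightarrow> 'b" where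
  "elem = inv_into (carrier M) coord"

lemma elem_carrier: "Poly_Mapping.keys f \<subseteq> C \<Longrightarrow> elem f \<in> carrier M"
  unfolding elem_def using coord_bij by (intro inv_into_into) (auto simp: bij_betw_def)

lemma coord_elem: "Poly_Mapping.keys f \<subseteq> C \<Longrightarrow> coord (elem f) = f"
  unfolding elem_def using coord_bij by (intro f_inv_into_f) (auto simp: bij_betw_def)

lemma coord_zero: "coord \<zero>\<^bsub>M\<^esub> = 0"
  using coord_add[of "\<zero>\<^bsub>M\<^esub>" "\<zero>\<^bsub>M\<^esub>"] by simp

lemma coord_eq_0_iff: "x \<in> carrier M \<Longrightarrow> coord x = 0 \<longleftrightarrow> x = \<zero>\<^bsub>M\<^esub>"
  using coord_inject[of x "\<zero>\<^bsub>M\<^esub>"] by (simp add: coord_zero)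

lemma coord_minus:
  assumes "x \<in> carrier M"
  shows "coord (\<ominus>\<^bsub>M\<^esub> x) = - coord x"
proof -
  have "coord (\<ominus>\<^bsub>M\<^esub> x) + coord x = 0"
    using assms coord_add[of "\<ominus>\<^bsub>M\<^esub> x" x] by (simp add: M.l_neg coord_zero)
  then show ?thesis
    by (simp add: eq_neg_iff_add_eq_0)
qed

lemma coord_finsum:
  assumes "\<And>j. j \<in> J \<Longrightarrow> c j \<in> carrier M"
  shows "coord (\<Oplus>\<^bsub>M\<^esub> j\<in>J. c j) = (\<Sum>j\<in>J. coord (c j))"
  using assms
proof (induction J rule: infinite_finite_induct)
  case (infinite J)
  then show ?case by (simp add: coord_zero M.finsum_infinite)
next
  case empty
  then show ?case by (simp add: coord_zero)
next
  case (insert j J)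
  then show ?case
    by (subst M.finsum_insert) (auto simp: coord_add Pi_iff)
qed

lemma additive_subgroup_keys:
  "additive_subgroup {x \<in> carrier M. Poly_Mapping.keys (coord x) \<subseteq> A} M"
proof (rule additive_subgroupI, rule M.add.subgroupI)
  show "{x \<in> carrier M. Poly_Mapping.keys (coord x) \<subseteq> A} \<noteq> {}"
    using M.zero_closed by (force simp: coord_zero)
next
  fix x y assume "x \<in> {x \<in> carrier M. Poly_Mapping.keys (coord x) \<subseteq> A}"
    "y \<in> {x \<in> carrier M. Poly_Mapping.keys (coord x) \<subseteq> A}"
  then show "x \<oplus>\<^bsub>M\<^esub> y \<in> {x \<in> carrier M. Poly_Mapping.keys (coord x) \<subseteq> A}"
    using keys_add[of "coord x" "coord y"] by (auto simp: coord_add)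
qed (auto simp: coord_minus)

lemma homogeneousE:
  assumes "m \<in> grade M a" "m \<noteq> \<zero>\<^bsub>M\<^esub>"
  obtains t c where "t \<in> C" "c \<noteq> 0" "coord m = Poly_Mapping.single t c"
proof -
  have m: "m \<in> carrier M" "coord m \<in> poly_grade a"
    using assms(1) by (auto simp: grade_eq)
  then have "coord m \<noteq> 0"
    using assms(2) coord_eq_0_iff by blast
  with m(2) obtain t c where "c \<noteq> 0" "coord m = Poly_Mapping.single t c"
    by (rule poly_grade_nonzeroE)
  then show thesis
    using that coord_keys[OF m(1)] by auto
qed

text \<open>As the block lies in \<open>C\<close>, no term of a product of \<open>m\<close> with an
  element of \<open>K[Z]\<close> is deleted, so the space is a copy of \<open>K[Z]\<close> times the
  term \<open>c\<close> x^\<open>t\<close>.\<close>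

lemma stanley_space_eq:
  assumes m: "m \<in> carrier M" "coord m = Poly_Mapping.single t c" "c \<noteq> 0" and sub: "block t Z \<subseteq> C"
  shows "stanley_space M m Z = {x \<in> carrier M. Poly_Mapping.keys (coord x) \<subseteq> block t Z}"
proof (intro equalityI subsetI)
  fix x assume "x \<in> stanley_space M m Z"
  then obtain f where f: "x = f \<odot>\<^bsub>M\<^esub> m" "\<And>s. s \<in> Poly_Mapping.keys f \<Longrightarrow> Poly_Mapping.keys s \<subseteq> Z"
    by (auto simp: stanley_space_def)
  have "Poly_Mapping.keys (coord x) \<subseteq> (\<lambda>s. s + t) ` Poly_Mapping.keys f"
    unfolding f(1) coord_smult[OF m(1)] m(2) keys_restrict_terms keys_mult_single[OF m(3)] by blast
  also have "\<dots> \<subseteq> block t Z"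
    using f(2) add_mem_block by (force simp: add.commute)
  finally show "x \<in> {x \<in> carrier M. Poly_Mapping.keys (coord x) \<subseteq> block t Z}"
    using f(1) m(1) by simp
next
  fix x assume "x \<in> {x \<in> carrier M. Poly_Mapping.keys (coord x) \<subseteq> block t Z}"
  then have x: "x \<in> carrier M" "Poly_Mapping.keys (coord x) \<subseteq> block t Z"
    by auto
  \<comment> \<open>The quotient of \<open>coord x\<close> by the term \<open>coord m\<close>, taken
    term by term; the subtraction \<open>u - t\<close> is exact on the block.\<close>
  define f where
    "f = (\<Sum>u \<in> Poly_Mapping.keys (coord x).
       Poly_Mapping.single (u - t) (Poly_Mapping.lookup (coord x) u / c))"
  have "f * Poly_Mapping.single t c =
      (\<Sum>u \<in> Poly_Mapping.keys (coord x). Poly_Mapping.single u (Poly_Mapping.lookup (coord x) u))"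
    unfolding f_def sum_distrib_right
    by (rule sum.cong) (use x(2) m(3) in \<open>auto simp: mult_single block_def subset_iff add.commute\<close>)
  then have f_mult: "f * Poly_Mapping.single t c = coord x"
    by (simp add: sum_single_lookup)
  then have "coord (f \<odot>\<^bsub>M\<^esub> m) = coord x"
    using m coord_keys[OF x(1)] by (simp add: coord_smult restrict_terms_same)
  then have "x = f \<odot>\<^bsub>M\<^esub> m"
    using coord_inject[OF x(1), of "f \<odot>\<^bsub>M\<^esub> m"] m(1) by simp
  moreover have "Poly_Mapping.keys s \<subseteq> Z" if "s \<in> Poly_Mapping.keys f" for s
  proof -
    have "s + t \<in> block t Z"
      using that x(2) keys_mult_single[OF m(3), of f t] unfolding f_mult by blast
    then show ?thesis
      by (auto simp: block_def add.commute)
  qed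
  ultimately show "x \<in> stanley_space M m Z"
    by (auto simp: stanley_space_def)
qed

lemma module_stanley_space:
  assumes m: "m \<in> carrier M"
  shows "module (vars_subalgebra Z) (M\<lparr>carrier := stanley_space M m Z\<rparr>)"
proof -
  note closed = vars_subalgebra_closed[where Z = Z]
  have carr: "x \<in> carrier M" if "x \<in> stanley_space M m Z" for x
    using that m by (auto simp: stanley_space_def)
  have smult_mem: "f \<odot>\<^bsub>M\<^esub> m \<in> stanley_space M m Z" if "f \<in> carrier (vars_subalgebra Z)" for f
    using that unfolding stanley_space_def by blast
  have dest: "\<exists>f. f \<in> carrier (vars_subalgebra Z) \<and> x = f \<odot>\<^bsub>M\<^esub> m" if "x \<in> stanley_space M m Z" for x
    using that unfolding stanley_space_def by blast
  have distr: "(f + g) \<odot>\<^bsub>M\<^esub> x = f \<odot>\<^bsub>M\<^esub> x \<oplus>\<^bsub>M\<^esub> g \<odot>\<^bsub>M\<^esub> x" if "x \<in> carrier M" for f g x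
    using smult_l_distr[of f g x] that by simp
  have assoc: "(f * g) \<odot>\<^bsub>M\<^esub> x = f \<odot>\<^bsub>M\<^esub> (g \<odot>\<^bsub>M\<^esub> x)" if "x \<in> carrier M" for f g x
    using smult_assoc1[of f g x] that by simp
  have null: "0 \<odot>\<^bsub>M\<^esub> x = \<zero>\<^bsub>M\<^esub>" and one: "1 \<odot>\<^bsub>M\<^esub> x = x" if "x \<in> carrier M" for x
    using smult_l_null[of x] smult_one[of x] that by simp_all
  have add_mem: "x \<oplus>\<^bsub>M\<^esub> y \<in> stanley_space M m Z"
    if xy: "x \<in> stanley_space M m Z" "y \<in> stanley_space M m Z" for x y
  proof -
    obtain f g where "f \<in> carrier (vars_subalgebra Z)" "g \<in> carrier (vars_subalgebra Z)"
      "x = f \<odot>\<^bsub>M\<^esub> m" "y = g \<odot>\<^bsub>M\<^esub> m"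
      using xy dest by blast
    then show ?thesis
      using smult_mem[OF closed(3)[of f g]] distr[OF m] by simp
  qed
  show ?thesis
  proof (rule moduleI)
    show "abelian_group (M\<lparr>carrier := stanley_space M m Z\<rparr>)"
    proof (rule abelian_groupI)
      show "\<zero>\<^bsub>M\<lparr>carrier := stanley_space M m Z\<rparr>\<^esub> \<in> carrier (M\<lparr>carrier := stanley_space M m Z\<rparr>)"
        using smult_mem[OF closed(1)] null[OF m] by simp
      fix x assume "x \<in> carrier (M\<lparr>carrier := stanley_space M m Z\<rparr>)"
      then obtain f where f: "f \<in> carrier (vars_subalgebra Z)" "x = f \<odot>\<^bsub>M\<^esub> m"
        using dest by auto
      have "(- f) \<odot>\<^bsub>M\<^esub> m \<oplus>\<^bsub>M\<^esub> x = \<zero>\<^bsub>M\<^esub>"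
        unfolding f(2) distr[OF m, symmetric] using null[OF m] by simp
      then show "\<exists>y\<in>carrier (M\<lparr>carrier := stanley_space M m Z\<rparr>).
          y \<oplus>\<^bsub>M\<lparr>carrier := stanley_space M m Z\<rparr>\<^esub> x = \<zero>\<^bsub>M\<lparr>carrier := stanley_space M m Z\<rparr>\<^esub>"
        using smult_mem[OF closed(5)[OF f(1)]] by (intro bexI[of _ "(- f) \<odot>\<^bsub>M\<^esub> m"]) simp_all
    qed (auto simp: add_mem carr M.a_assoc intro: M.a_comm)
    fix f :: "('n, 'k) mpoly" and x
    assume fx: "f \<in> carrier (vars_subalgebra Z)"
      "x \<in> carrier (M\<lparr>carrier := stanley_space M m Z\<rparr>)"
    then obtain g where "g \<in> carrier (vars_subalgebra Z)" "x = g \<odot>\<^bsub>M\<^esub> m"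
      using dest[of x] by (auto simp del: vars_subalgebra_simps(1))
    then show "f \<odot>\<^bsub>M\<lparr>carrier := stanley_space M m Z\<rparr>\<^esub> x \<in> carrier (M\<lparr>carrier := stanley_space M m Z\<rparr>)"
      using smult_mem[OF closed(4)[OF fx(1)], of g] assoc[OF m] by simp
  qed (simp_all add: cring_vars_subalgebra carr distr assoc one smult_r_distr)
qed

text \<open>If \<open>t + s\<close> leaves \<open>C\<close> for some \<open>s\<close> supported in
  \<open>Z\<close>, then x^\<open>s\<close> kills \<open>m\<close>, contradicting cancellation in a
  free cyclic module. If the whole block stays in \<open>C\<close>, the action on \<open>m\<close>
  is ordinary multiplication by a nonzero term, which has trivial annihilator.\<close>

lemma free_stanley_space_iff:
  assumes m: "m \<in> carrier M" "coord m = Poly_Mapping.single t c" "c \<noteq> 0"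
  shows "free_module (vars_subalgebra Z) (M\<lparr>carrier := stanley_space M m Z\<rparr>) \<longleftrightarrow> block t Z \<subseteq> C"
proof
  have m_mem: "m \<in> stanley_space M m Z"
    using vars_subalgebra_closed(2)[where Z = Z] smult_one[OF m(1)]
    unfolding stanley_space_def by (intro CollectI exI[of _ 1]) simp
  have m_nz: "m \<noteq> \<zero>\<^bsub>M\<^esub>"
    using m single_nonzero[OF m(3), of t] coord_zero by auto
  {
    assume free: "free_module (vars_subalgebra Z) (M\<lparr>carrier := stanley_space M m Z\<rparr>)"
    show "block t Z \<subseteq> C"
    proof
      fix u assume "u \<in> block t Z"
      then obtain s where s: "u = t + s" "Poly_Mapping.keys s \<subseteq> Z"
        by (auto simp: block_def)
      let ?f = "Poly_Mapping.single s 1 :: ('n, 'k) mpoly"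
      have "?f \<odot>\<^bsub>M\<^esub> m \<noteq> \<zero>\<^bsub>M\<^esub>"
        using free_module_cyclic_cancel[OF free, of m ?f] m_mem m_nz s(2)
        single_nonzero[of "1 :: 'k" s]
        by (auto simp: stanley_space_def)
      then have "coord (?f \<odot>\<^bsub>M\<^esub> m) \<noteq> 0"
        using m(1) coord_eq_0_iff[of "?f \<odot>\<^bsub>M\<^esub> m"] by simp
      then have "restrict_terms C (Poly_Mapping.single u c) \<noteq> 0"
        using m by (simp add: coord_smult mult_single s(1) add.commute)
      then show "u \<in> C"
        using restrict_terms_disjoint[of "Poly_Mapping.single u c" C] m(3) by auto
    qed
  }
  assume sub: "block t Z \<subseteq> C"
  show "free_module (vars_subalgebra Z) (M\<lparr>carrier := stanley_space M m Z\<rparr>)"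
  proof (rule free_module_cyclicI[of _ _ m])
    fix f :: "('n, 'k) mpoly"
    assume f: "f \<in> carrier (vars_subalgebra Z)"
      "f \<odot>\<^bsub>M\<lparr>carrier := stanley_space M m Z\<rparr>\<^esub> m = \<zero>\<^bsub>M\<lparr>carrier := stanley_space M m Z\<rparr>\<^esub>"
    have "Poly_Mapping.keys (f * Poly_Mapping.single t c) \<subseteq> block t Z"
      using f(1) add_mem_block[of _ Z t] by (auto simp: keys_mult_single[OF m(3)] add.commute)
    then have "coord (f \<odot>\<^bsub>M\<^esub> m) = f * Poly_Mapping.single t c"
      using m sub by (simp add: coord_smult restrict_terms_same)
    then have "f * Poly_Mapping.single t c = 0"
      using f(2) by (simp add: coord_zero)
    then show "f = \<zero>\<^bsub>vars_subalgebra Z\<^esub>"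
      using keys_mult_single[OF m(3), of f t] by simp
  qed (auto simp: module_stanley_space[OF m(1)] m_mem, auto simp: stanley_space_def)
qed

text \<open>Each nonzero generator yields a block. Expanding single monomials shows that the blocks
  cover \<open>C\<close>; directness of the sum shows that they are disjoint.\<close>

lemma stanley_decomposition_block_depth_ge:
  assumes D: "stanley_decomposition M D"
  shows "block_depth_ge C (sdepth_decomposition D)"
proof -
  define m Z where "m i = fst (D ! i)" and "Z i = snd (D ! i)" for i
  \<comment> \<open>\<open>m i = 0\<close> is allowed, because the zero module is free; such summands are discarded.\<close>
  define J where "J = {i \<in> {..<length D}. m i \<noteq> \<zero>\<^bsub>M\<^esub>}"
  have in_D: "(m i, Z i) \<in> set D" if "i < length D" for i
    using that by (simp add: m_def Z_def)
  have mem: "m i \<in> carrier M" "\<exists>a. m i \<in> grade M a"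
    "free_module (vars_subalgebra (Z i)) (M\<lparr>carrier := stanley_space M (m i) (Z i)\<rparr>)"
    if "i < length D" for i
    using D in_D[OF that] unfolding stanley_decomposition_def by auto
  have sum: "is_direct_sum M {..<length D} (\<lambda>i. stanley_space M (m i) (Z i))"
    using D unfolding stanley_decomposition_def m_def Z_def by blast
  have "\<exists>t. block t (Z i) \<subseteq> C \<and> stanley_space M (m i) (Z i) =
      {x \<in> carrier M. Poly_Mapping.keys (coord x) \<subseteq> block t (Z i)}" if "i \<in> J" for i
  proof -
    from that have i: "i < length D" "m i \<noteq> \<zero>\<^bsub>M\<^esub>"
      by (auto simp: J_def)
    obtain a where "m i \<in> grade M a"
      using mem(2)[OF i(1)] by blast
    then obtain t c where t: "c \<noteq> 0" "coord (m i) = Poly_Mapping.single t c"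
      using i(2) by (rule homogeneousE)
    then have "block t (Z i) \<subseteq> C"
      using free_stanley_space_iff[OF mem(1)[OF i(1)] t(2,1)] mem(3)[OF i(1)] by blast
    then show ?thesis
      using stanley_space_eq[OF mem(1)[OF i(1)] t(2,1)] by blast
  qed
  then have "\<exists>t. \<forall>i\<in>J. block (t i) (Z i) \<subseteq> C \<and> stanley_space M (m i) (Z i) =
      {x \<in> carrier M. Poly_Mapping.keys (coord x) \<subseteq> block (t i) (Z i)}"
    by (intro bchoice ballI)
  then obtain t where t: "\<And>i. i \<in> J \<Longrightarrow> block (t i) (Z i) \<subseteq> C"
    "\<And>i. i \<in> J \<Longrightarrow> stanley_space M (m i) (Z i) =
      {x \<in> carrier M. Poly_Mapping.keys (coord x) \<subseteq> block (t i) (Z i)}"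
    by blast
  have zero_space: "stanley_space M (m i) (Z i) \<subseteq> {\<zero>\<^bsub>M\<^esub>}" if "i < length D" "i \<notin> J" for i
    using that by (auto simp: J_def stanley_space_def)
  show ?thesis
  proof (rule block_depth_geI[of "(\<lambda>i. (t i, Z i)) ` J"])
    show "finite ((\<lambda>i. (t i, Z i)) ` J)"
      by (simp add: J_def)
    have "u \<in> (\<Union>i\<in>J. block (t i) (Z i))" if u: "u \<in> C" for u
    proof -
      \<comment> \<open>The test element for \<open>u\<close>: some component of its expansion must
        have \<open>u\<close> among its exponents, and \<open>u\<close> then lies in the block of
        that component.\<close>
      define x where "x = elem (Poly_Mapping.single u 1)"
      have x: "x \<in> carrier M" "coord x = Poly_Mapping.single u 1"
        using u by (simp_all add: x_def elem_carrier coord_elem)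
      obtain c where c: "c \<in> (\<Pi>\<^sub>E i\<in>{..<length D}. stanley_space M (m i) (Z i))"
        "x = (\<Oplus>\<^bsub>M\<^esub> i\<in>{i\<in>{..<length D}. c i \<noteq> \<zero>\<^bsub>M\<^esub>}. c i)"
        using sum x(1) unfolding is_direct_sum_def by blast
      have c_carr: "c i \<in> carrier M" if "i < length D" for i
      proof -
        have "c i \<in> stanley_space M (m i) (Z i)"
          using c(1) that by auto
        then show ?thesis
          using mem(1)[OF that] by (auto simp: stanley_space_def)
      qed
      have "Poly_Mapping.lookup (coord x) u \<noteq> 0"
        by (simp add: x(2))
      moreover have "coord x = (\<Sum>i\<in>{i\<in>{..<length D}. c i \<noteq> \<zero>\<^bsub>M\<^esub>}. coord (c i))"
        unfolding c(2) by (rule coord_finsum) (simp add: c_carr)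
      ultimately obtain i where i: "i < length D" "c i \<noteq> \<zero>\<^bsub>M\<^esub>"
        "Poly_Mapping.lookup (coord (c i)) u \<noteq> 0"
        by (auto simp: lookup_sum elim!: sum.not_neutral_contains_not_neutral)
      have ci: "c i \<in> stanley_space M (m i) (Z i)"
        using c(1) i(1) by auto
      then have "i \<in> J"
        using zero_space i by blast
      then show ?thesis
        using t(2) ci i(3) by (auto simp: in_keys_iff)
    qed
    then show "C = (\<Union>(t, Z)\<in>(\<lambda>i. (t i, Z i)) ` J. block t Z)"
      using t(1) by auto
    \<comment> \<open>The minimum is taken over all pairs of \<open>D\<close>, discarded ones
      included, so it is at most the size of each retained \<open>Z i\<close>.\<close>
    show "sdepth_decomposition D \<le> card Y" if sY: "(s, Y) \<in> (\<lambda>i. (t i, Z i)) ` J" for s Y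
    proof -
      obtain i where "i < length D" "Y = Z i"
        using sY by (auto simp: J_def)
      then have "card Y \<in> (\<lambda>(m, Z). card Z) ` set D"
        using in_D by force
      then show ?thesis
        by (simp add: sdepth_decomposition_eq)
    qed
    fix s Y s' Y' u
    assume "(s, Y) \<in> (\<lambda>i. (t i, Z i)) ` J" "(s', Y') \<in> (\<lambda>i. (t i, Z i)) ` J"
      and u: "u \<in> block s Y" "u \<in> block s' Y'"
    then obtain i j where i: "i \<in> J" "s = t i" "Y = Z i" and j: "j \<in> J" "s' = t j" "Y' = Z j"
      by blast
    \<comment> \<open>A shared exponent \<open>u\<close> puts this nonzero element into both Stanley
      spaces, which directness allows only for equal indices.\<close>
    define x where "x = elem (Poly_Mapping.single u 1)"
    have "u \<in> C"
      using t(1) i u(1) by blast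
    then have x: "x \<in> carrier M" "coord x = Poly_Mapping.single u 1"
      by (simp_all add: x_def elem_carrier coord_elem)
    then have "x \<in> stanley_space M (m i) (Z i)" "x \<in> stanley_space M (m j) (Z j)"
      using t(2) i j u by auto
    then have "x = \<zero>\<^bsub>M\<^esub>" if "i \<noteq> j"
      using M.direct_sum_disjoint[OF sum, of i j x] that i(1) j(1) by (auto simp: J_def)
    moreover have "x \<noteq> \<zero>\<^bsub>M\<^esub>"
      using x(2) single_nonzero[of "1 :: 'k" u] coord_zero by auto
    ultimately show "s = s' \<and> Y = Y'"
      using i j by blast
  qed
qed

text \<open>A block with corner \<open>t\<close> is realised by the basis element of exponent
  \<open>t\<close>. The components of \<open>x\<close> are the restrictions of
  \<open>coord x\<close> to the blocks, so existence comes from covering and uniqueness from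
  disjointness.\<close>

lemma block_depth_ge_stanley_decomposition:
  assumes "block_depth_ge C d" "C \<noteq> {}"
  obtains D where "stanley_decomposition M D" "d \<le> sdepth_decomposition D"
proof -
  from assms(1) obtain P where P: "finite P" "C = (\<Union>(t, Z)\<in>P. block t Z)"
    "\<And>t Z. (t, Z) \<in> P \<Longrightarrow> d \<le> card Z"
    "\<And>t Z t' Z' u. (t, Z) \<in> P \<Longrightarrow> (t', Z') \<in> P \<Longrightarrow> u \<in> block t Z \<Longrightarrow> u \<in> block t' Z' \<Longrightarrow>
       t = t' \<and> Z = Z'"
    by (rule block_depth_geE) blast
  \<comment> \<open>Without repetitions, so that different indices carry different, hence disjoint,
    blocks.\<close>
  obtain ps where ps: "set ps = P" "distinct ps"
    using finite_distinct_list[OF P(1)] by blast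
  define t Z where "t i = fst (ps ! i)" and "Z i = snd (ps ! i)" for i
  define m where "m i = elem (Poly_Mapping.single (t i) 1)" for i
  define D where "D = map (\<lambda>i. (m i, Z i)) [0..<length ps]"
  define n where "n = length ps"
  have in_P: "(t i, Z i) \<in> P" if "i < n" for i
    using that ps(1) by (auto simp: t_def Z_def n_def)
  have sub: "block (t i) (Z i) \<subseteq> C" if "i < n" for i
    using in_P[OF that] P(2) by blast
  have block_inj: "i = j" if ij: "i < n" "j < n" and u: "u \<in> block (t i) (Z i)" "u \<in> block (t j) (Z j)"
    for i j u
  proof -
    have "ps ! i = ps ! j"
      using P(4)[OF in_P[OF ij(1)] in_P[OF ij(2)] u] by (simp add: t_def Z_def prod_eq_iff)
    then show ?thesis
      using ps(2) ij by (simp add: nth_eq_iff_index_eq n_def)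
  qed
  have cover: "\<exists>i<n. u \<in> block (t i) (Z i)" if "u \<in> C" for u
  proof -
    obtain p where "p \<in> P" "u \<in> block (fst p) (snd p)"
      using P(2) \<open>u \<in> C\<close> by auto
    then show ?thesis
      unfolding ps(1)[symmetric] t_def Z_def n_def by (auto simp: in_set_conv_nth)
  qed
  have "t i \<in> C" if "i < n" for i
    using sub[OF that] block_self by blast
  then have m: "m i \<in> carrier M" "coord (m i) = Poly_Mapping.single (t i) 1" if "i < n" for i
    using that by (simp_all add: m_def elem_carrier coord_elem)
  define N where "N i = {x \<in> carrier M. Poly_Mapping.keys (coord x) \<subseteq> block (t i) (Z i)}" for i
  have N: "stanley_space M (m i) (Z i) = N i" if "i < n" for i
    unfolding N_def using stanley_space_eq[OF m[OF that] _ sub[OF that]] by simp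
  have "is_direct_sum M {..<n} (\<lambda>i. stanley_space M (m i) (Z i))"
    unfolding is_direct_sum_def
  proof (intro conjI ballI)
    show "additive_subgroup (stanley_space M (m i) (Z i)) M" if "i \<in> {..<n}" for i
      using that additive_subgroup_keys by (simp add: N N_def)
    fix x assume x: "x \<in> carrier M"
    define c where "c = (\<lambda>i\<in>{..<n}. elem (restrict_terms (block (t i) (Z i)) (coord x)))"
    have keys_C: "Poly_Mapping.keys (restrict_terms (block (t i) (Z i)) (coord x)) \<subseteq> C" for i
      using coord_keys[OF x] by (auto simp: keys_restrict_terms)
    have c: "c i \<in> carrier M" "coord (c i) = restrict_terms (block (t i) (Z i)) (coord x)" if "i < n" for i
      using that keys_C by (simp_all add: c_def elem_carrier coord_elem)
    have coord_sum: "coord (\<Oplus>\<^bsub>M\<^esub> i\<in>{i\<in>{..<n}. b i \<noteq> \<zero>\<^bsub>M\<^esub>}. b i) = (\<Sum>i<n. coord (b i))"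
      if b: "\<And>i. i < n \<Longrightarrow> b i \<in> carrier M" for b
    proof -
      have "coord (\<Oplus>\<^bsub>M\<^esub> i\<in>{i\<in>{..<n}. b i \<noteq> \<zero>\<^bsub>M\<^esub>}. b i) = (\<Sum>i\<in>{i\<in>{..<n}. b i \<noteq> \<zero>\<^bsub>M\<^esub>}. coord (b i))"
        by (rule coord_finsum) (simp add: b)
      \<comment> \<open>Indices outside the support contribute 0, so the sum may run over all
        indices.\<close>
      also have "\<dots> = (\<Sum>i<n. coord (b i))"
        by (rule sum.mono_neutral_left) (auto simp: coord_zero)
      finally show ?thesis .
    qed
    have "(\<Sum>i<n. coord (c i)) = coord x"
    proof (rule poly_mapping_eqI)
      fix u
      have "Poly_Mapping.lookup (\<Sum>i<n. coord (c i)) u =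
          (\<Sum>i<n. if u \<in> block (t i) (Z i) then Poly_Mapping.lookup (coord x) u else 0)"
        unfolding lookup_sum by (rule sum.cong) (simp_all add: c lookup_restrict_terms)
      also have "\<dots> = Poly_Mapping.lookup (coord x) u"
      proof (cases "u \<in> C")
        case True
        then obtain i where i: "i < n" "u \<in> block (t i) (Z i)"
          using cover by blast
        have "(\<Sum>j<n. if u \<in> block (t j) (Z j) then Poly_Mapping.lookup (coord x) u else 0) =
            (\<Sum>j<n. if j = i then Poly_Mapping.lookup (coord x) u else 0)"
        proof (rule sum.cong)
          fix j assume "j \<in> {..<n}"
          then have "u \<in> block (t j) (Z j) \<longleftrightarrow> j = i"
            using i block_inj[of j i u] by blast
          then show "(if u \<in> block (t j) (Z j) then Poly_Mapping.lookup (coord x) u else 0) =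
              (if j = i then Poly_Mapping.lookup (coord x) u else 0)"
            by simp
        qed simp
        then show ?thesis
          using i(1) by simp
      next
        case False
        then have "Poly_Mapping.lookup (coord x) u = 0"
          using coord_keys[OF x] by (auto simp: in_keys_iff)
        then show ?thesis
          by (simp cong: if_cong)
      qed
      finally show "Poly_Mapping.lookup (\<Sum>i<n. coord (c i)) u = Poly_Mapping.lookup (coord x) u" .
    qed
    then have "coord x = coord (\<Oplus>\<^bsub>M\<^esub> i\<in>{i\<in>{..<n}. c i \<noteq> \<zero>\<^bsub>M\<^esub>}. c i)"
      using coord_sum[of c] c(1) by simp
    moreover have "(\<Oplus>\<^bsub>M\<^esub> i\<in>{i\<in>{..<n}. c i \<noteq> \<zero>\<^bsub>M\<^esub>}. c i) \<in> carrier M"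
      using c(1) by (intro M.finsum_closed) auto
    ultimately have x_eq: "x = (\<Oplus>\<^bsub>M\<^esub> i\<in>{i\<in>{..<n}. c i \<noteq> \<zero>\<^bsub>M\<^esub>}. c i)"
      using coord_inject[OF x] by blast
    show "\<exists>!c. c \<in> (\<Pi>\<^sub>E i\<in>{..<n}. stanley_space M (m i) (Z i)) \<and>
        finite {i\<in>{..<n}. c i \<noteq> \<zero>\<^bsub>M\<^esub>} \<and> x = (\<Oplus>\<^bsub>M\<^esub> i\<in>{i\<in>{..<n}. c i \<noteq> \<zero>\<^bsub>M\<^esub>}. c i)"
    proof (rule ex1I[of _ c], intro conjI)
      show "c \<in> (\<Pi>\<^sub>E i\<in>{..<n}. stanley_space M (m i) (Z i))"
        using c by (auto simp: PiE_iff N N_def keys_restrict_terms) (simp add: c_def)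
      show "x = (\<Oplus>\<^bsub>M\<^esub> i\<in>{i\<in>{..<n}. c i \<noteq> \<zero>\<^bsub>M\<^esub>}. c i)" by (rule x_eq)
      fix b assume b: "b \<in> (\<Pi>\<^sub>E i\<in>{..<n}. stanley_space M (m i) (Z i)) \<and>
        finite {i\<in>{..<n}. b i \<noteq> \<zero>\<^bsub>M\<^esub>} \<and> x = (\<Oplus>\<^bsub>M\<^esub> i\<in>{i\<in>{..<n}. b i \<noteq> \<zero>\<^bsub>M\<^esub>}. b i)"
      have b_mem: "b i \<in> carrier M" "Poly_Mapping.keys (coord (b i)) \<subseteq> block (t i) (Z i)" if "i < n" for i
        using b that by (auto simp: PiE_iff N N_def)
      have x_sum: "coord x = (\<Sum>i<n. coord (b i))"
        using b coord_sum[of b] b_mem(1) by simp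
      show "b = c"
      proof
        fix i
        show "b i = c i"
        proof (cases "i < n")
          case True
          \<comment> \<open>Restricting the given expansion of \<open>x\<close> to the block of
            index \<open>i\<close> leaves only its component \<open>b i\<close>, since the other
            components are supported on disjoint blocks.\<close>
          have "coord (c i) = (\<Sum>j<n. restrict_terms (block (t i) (Z i)) (coord (b j)))"
            unfolding c(2)[OF True] x_sum restrict_terms_sum ..
          also have "\<dots> = (\<Sum>j<n. if j = i then coord (b i) else 0)"
          proof (rule sum.cong)
            fix j assume "j \<in> {..<n}"
            then have j: "j < n" by simp
            show "restrict_terms (block (t i) (Z i)) (coord (b j)) = (if j = i then coord (b i) else 0)"
            proof (cases "j = i")
              case True
              then show ?thesis
                using b_mem(2)[OF j] by (simp add: restrict_terms_same)
            next
              case False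
              then have "Poly_Mapping.keys (coord (b j)) \<inter> block (t i) (Z i) = {}"
                using b_mem(2)[OF j] block_inj[OF j True] by blast
              then show ?thesis
                using False by (simp add: restrict_terms_disjoint)
            qed
          qed simp
          also have "\<dots> = coord (b i)"
            using True by simp
          finally show ?thesis
            using coord_inject[OF b_mem(1)[OF True] c(1)[OF True]] by simp
        next
          case False
          then show ?thesis
            using b by (auto simp: c_def PiE_iff extensional_def)
        qed
      qed
    qed simp
  qed
  moreover have "is_direct_sum M {..<n} (\<lambda>i. stanley_space M (m i) (Z i)) \<longleftrightarrow>
      is_direct_sum M {..<length D} (\<lambda>i. stanley_space M (fst (D ! i)) (snd (D ! i)))"
  proof -
    have "(\<Pi>\<^sub>E i\<in>{..<n}. stanley_space M (m i) (Z i)) =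
        (\<Pi>\<^sub>E i\<in>{..<n}. stanley_space M (fst (D ! i)) (snd (D ! i)))"
      by (rule PiE_cong) (simp add: D_def n_def)
    moreover have "length D = n"
      by (simp add: D_def n_def)
    ultimately show ?thesis
      unfolding is_direct_sum_def by (simp add: D_def n_def)
  qed
  moreover have "m i \<in> carrier M \<and> (\<exists>a. m i \<in> grade M a) \<and>
      free_module (vars_subalgebra (Z i)) (M\<lparr>carrier := stanley_space M (m i) (Z i)\<rparr>)" if "i < n" for i
  proof (intro conjI exI)
    show "m i \<in> grade M (degree_vec (t i))"
      using m[OF that] by (simp add: grade_eq poly_grade_eq)
  qed (use m[OF that] sub[OF that] free_stanley_space_iff[of "m i"] in auto)
  ultimately have "stanley_decomposition M D"
    unfolding stanley_decomposition_def by (auto simp: D_def n_def)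
  \<comment> \<open>This makes \<open>sdepth_decomposition D\<close> the minimum of a nonempty
    set.\<close>
  moreover have "D \<noteq> []"
    using cover assms(2) by (auto simp: D_def n_def)
  then have "d \<le> sdepth_decomposition D"
    using P(3)[OF in_P] unfolding sdepth_decomposition_eq
    by (subst Min_ge_iff) (auto simp: D_def n_def)
  ultimately show thesis
    by (rule that)
qed

text \<open>The right-hand set contains every depth of a decomposition, and each of its members is
  bounded by such a depth. So the two finite sets, though different in general, have the same
  maximum.\<close>

lemma sdepth_eq:
  assumes "C \<noteq> {}"
  shows "sdepth M = Max {d. block_depth_ge C d}"
proof (cases "{d. block_depth_ge C d} = {}")
  \<comment> \<open>Here both sides are \<open>Max {}\<close>.\<close>
  case True
  then have "{sdepth_decomposition D |D. stanley_decomposition M D} = {}"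
    using stanley_decomposition_block_depth_ge by blast
  with True show ?thesis
    unfolding sdepth_def by simp
next
  case False
  have fin: "finite {d. block_depth_ge C d}"
  proof (rule finite_subset)
    show "{d. block_depth_ge C d} \<subseteq> {..CARD('n)}"
      using block_depth_ge_le_card[OF _ assms] by blast
  qed simp
  have sub: "{sdepth_decomposition D |D. stanley_decomposition M D} \<subseteq> {d. block_depth_ge C d}"
    using stanley_decomposition_block_depth_ge by blast
  show ?thesis
    unfolding sdepth_def
  proof (rule antisym)
    show "Max {sdepth_decomposition D |D. stanley_decomposition M D} \<le> Max {d. block_depth_ge C d}"
      using False block_depth_ge_stanley_decomposition[OF _ assms]
      by (intro Max_mono[OF sub _ fin]) blast
    obtain D where D: "stanley_decomposition M D" "Max {d. block_depth_ge C d} \<le> sdepth_decomposition D"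
      using Max_in[OF fin False] block_depth_ge_stanley_decomposition[OF _ assms] by blast
    note D(2)
    also have "sdepth_decomposition D \<le> Max {sdepth_decomposition D |D. stanley_decomposition M D}"
      using D(1) by (intro Max_ge finite_subset[OF sub fin]) blast
    finally show "Max {d. block_depth_ge C d} \<le> Max {sdepth_decomposition D |D. stanley_decomposition M D}" .
  qed
qed

end


section \<open>Monomial ideals and their quotients\<close>

definition exponents :: "('n, 'k::field) mpoly set \<Rightarrow> ('n \<Rightarrow>\<^sub>0 nat) set" where
  "exponents I = {t. Poly_Mapping.single t 1 \<in> I}"

lemma ideal_mem_if_keys:
  fixes I :: "('n, 'k::field) mpoly set"
  assumes I: "ideal I polyring" and f: "Poly_Mapping.keys f \<subseteq> exponents I"
  shows "f \<in> I"
proof -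
  have "(\<Sum>t \<in> Poly_Mapping.keys f. Poly_Mapping.single t (Poly_Mapping.lookup f t)) \<in> I"
  proof (rule ideal_polyringD(6)[OF I])
    fix t assume "t \<in> Poly_Mapping.keys f"
    then have "Poly_Mapping.single 0 (Poly_Mapping.lookup f t) * Poly_Mapping.single t 1 \<in> I"
      using f by (intro ideal_polyringD(3)[OF I]) (auto simp: exponents_def)
    then show "Poly_Mapping.single t (Poly_Mapping.lookup f t) \<in> I"
      by (simp add: mult_single)
  qed
  then show ?thesis
    by (simp add: sum_single_lookup)
qed

lemma monomial_ideal_mem_iff:
  assumes "monomial_ideal I"
  shows "f \<in> I \<longleftrightarrow> Poly_Mapping.keys f \<subseteq> exponents I"
proof
  show "f \<in> I \<Longrightarrow> Poly_Mapping.keys f \<subseteq> exponents I"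
    using monomial_ideal_term[OF assms] unfolding exponents_def by blast
qed (rule ideal_mem_if_keys[OF monomial_ideal_is_ideal[OF assms]])

text \<open>The monomials in \<open>I\<close> generate \<open>I\<close>, because each
  \<open>f\<close> in \<open>I\<close> is a combination of its own terms. Used to see that a colon
  ideal is again monomial.\<close>

lemma monomial_idealI:
  fixes I :: "('n, 'k::field) mpoly set"
  assumes I: "ideal I polyring" and "\<And>f. f \<in> I \<Longrightarrow> Poly_Mapping.keys f \<subseteq> exponents I"
  shows "monomial_ideal I"
proof -
  interpret cring "polyring :: ('n, 'k) mpoly ring" by (rule cring_polyring)
  let ?A = "(\<lambda>t. Poly_Mapping.single t 1) ` exponents I :: ('n, 'k) mpoly set"
  have "ideal (Idl\<^bsub>polyring\<^esub> ?A) polyring"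
    by (rule genideal_ideal) simp
  moreover have "exponents I \<subseteq> exponents (Idl\<^bsub>polyring\<^esub> ?A)"
    using genideal_self[of ?A] by (auto simp: exponents_def)
  ultimately have "I \<subseteq> Idl\<^bsub>polyring\<^esub> ?A"
    using assms(2) ideal_mem_if_keys by blast
  moreover have "Idl\<^bsub>polyring\<^esub> ?A \<subseteq> I"
    by (rule genideal_minimal[OF I]) (auto simp: exponents_def)
  ultimately show ?thesis
    unfolding monomial_ideal_def by (intro exI[of _ ?A]) (auto simp: monomials_def)
qed

text \<open>An ideal absorbs products, so the deletion of terms outside its exponents never takes
  effect.\<close>

lemma monomial_module_ideal_module:
  fixes I :: "('n::finite, 'k::field) mpoly set"
  assumes mon: "monomial_ideal I"
  shows "monomial_module (ideal_module I) (exponents I) (\<lambda>f. f)"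
proof -
  have I: "ideal I polyring" by (rule monomial_ideal_is_ideal[OF mon])
  have "f * g \<in> I" if "g \<in> I" for f g
    using ideal_polyringD(3)[OF I that] .
  then show ?thesis
    by (intro monomial_module.intro monomial_module_axioms.intro module_ideal_module[OF I])
      (auto simp: bij_betw_def monomial_ideal_mem_iff[OF mon] restrict_terms_same)
qed

text \<open>The coordinates of a coset are its normal form: any representative with the terms lying
  in \<open>I\<close> removed. The representative picked by \<open>SOME\<close> does not
  matter.\<close>

lemma monomial_module_quotient_module:
  fixes I :: "('n::finite, 'k::field) mpoly set"
  assumes mon: "monomial_ideal I"
  shows "monomial_module (quotient_module I) (- exponents I)
    (\<lambda>x. restrict_terms (- exponents I) (SOME f. x = I +>\<^bsub>polyring\<^esub> f))"
proof -
  have I: "ideal I polyring" by (rule monomial_ideal_is_ideal[OF mon])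
  define Q where "Q = polyring Quot I"
  define p where "p = (+>\<^bsub>polyring\<^esub>) I"
  define C where "C = - exponents I"
  interpret h: ring_hom_cring polyring Q p
    unfolding Q_def p_def by (rule ideal.rcos_ring_hom_cring[OF I cring_polyring])
  have p_carr: "p f \<in> carrier Q" for f
    using h.hom_closed[of f] by simp
  have p_add: "p (f + g) = p f \<oplus>\<^bsub>Q\<^esub> p g" and p_mult: "p (f * g) = p f \<otimes>\<^bsub>Q\<^esub> p g" for f g
    using h.hom_add[of f g] h.hom_mult[of f g] by simp_all
  have minus: "\<ominus>\<^bsub>polyring\<^esub> f = - f" for f :: "('n, 'k) mpoly"
    by (rule h.R.minus_equality) simp_all
  have p_eq: "p f = p g \<longleftrightarrow> f - g \<in> I" for f g
    using h.R.quotient_eq_iff_same_a_r_cos[OF I, of f g]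
    by (auto simp: p_def a_minus_def minus)
  have p_surj: "\<exists>f. x = p f" if "x \<in> carrier Q" for x
    using that by (auto simp: Q_def p_def FactRing_def A_RCOSETS_def')
  note simps = quotient_module_simps[of I, folded Q_def p_def]
  define coord where "coord x = restrict_terms C (SOME f. x = p f)" for x
  \<comment> \<open>A polynomial lies in a monomial ideal exactly when its normal form vanishes;
    hence congruence is equality of normal forms.\<close>
  have diff_mem: "f - g \<in> I \<longleftrightarrow> restrict_terms C f = restrict_terms C g" for f g
  proof -
    have "f - g \<in> I \<longleftrightarrow> Poly_Mapping.keys (restrict_terms C (f - g)) = {}"
      unfolding monomial_ideal_mem_iff[OF mon] keys_restrict_terms C_def by blast
    then show ?thesis
      by (simp add: restrict_terms_diff)
  qed
  have coord_p: "coord (p f) = restrict_terms C f" for f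
  proof -
    have "p f = p (SOME g. p f = p g)"
      by (rule someI) (rule refl)
    then show ?thesis
      unfolding coord_def p_eq diff_mem by simp
  qed
  have restrict: "p (restrict_terms C f) = p f" for f
    unfolding p_eq diff_mem by (simp add: restrict_terms_same keys_restrict_terms)
  have "monomial_module (quotient_module I) C coord"
  proof (intro monomial_module.intro monomial_module_axioms.intro module_quotient_module[OF I])
    show "bij_betw coord (carrier (quotient_module I)) {f. Poly_Mapping.keys f \<subseteq> C}"
    proof (rule bij_betw_byWitness[of _ p])
      show "\<forall>x\<in>carrier (quotient_module I). p (coord x) = x"
        using p_surj by (force simp: simps coord_p restrict)
      show "coord ` carrier (quotient_module I) \<subseteq> {f. Poly_Mapping.keys f \<subseteq> C}"
        by (auto simp: coord_def keys_restrict_terms)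
    qed (auto simp: coord_p restrict_terms_same simps p_carr)
    fix x assume x: "x \<in> carrier (quotient_module I)"
    then obtain f where f: "x = p f"
      using p_surj by (auto simp: simps)
    show "coord (x \<oplus>\<^bsub>quotient_module I\<^esub> y) = coord x + coord y"
      if y: "y \<in> carrier (quotient_module I)" for y
    proof -
      obtain g where "y = p g"
        using p_surj y by (auto simp: simps)
      then show ?thesis
        by (simp add: f simps p_add[symmetric] coord_p restrict_terms_add)
    qed
    fix g
    have "g \<odot>\<^bsub>quotient_module I\<^esub> x = p (g * f)"
      by (simp add: f simps p_mult)
    \<comment> \<open>A representative may be replaced by its normal form before multiplying, as
      \<open>p\<close> is multiplicative.\<close>
    also have "\<dots> = p (g * restrict_terms C f)"
      using restrict[of f] by (simp add: p_mult)
    finally show "coord (g \<odot>\<^bsub>quotient_module I\<^esub> x) = restrict_terms C (g * coord x)"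
      by (simp add: coord_p f)
  next
    fix a :: "'n \<Rightarrow> int"
    show "grade (quotient_module I) a = {x \<in> carrier (quotient_module I). coord x \<in> poly_grade a}"
    proof (intro equalityI subsetI)
      fix x assume "x \<in> grade (quotient_module I) a"
      then show "x \<in> {x \<in> carrier (quotient_module I). coord x \<in> poly_grade a}"
        by (auto simp: simps p_carr coord_p poly_grade_eq keys_restrict_terms)
    next
      fix x assume "x \<in> {x \<in> carrier (quotient_module I). coord x \<in> poly_grade a}"
      then have x: "x \<in> carrier Q" "coord x \<in> poly_grade a"
        by (auto simp: simps)
      obtain f where "x = p f"
        using p_surj[OF x(1)] by blast
      moreover from this have "restrict_terms C f \<in> poly_grade a"
        using x(2) by (simp add: coord_p)
      ultimately show "x \<in> grade (quotient_module I) a"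
        unfolding simps using restrict[of f]
        by (intro image_eqI[of _ _ "restrict_terms C f"]) simp_all
    qed
  qed
  then show ?thesis
    unfolding C_def coord_def p_def .
qed

section \<open>Colon ideals by a monomial and principal ideals\<close>

lemma exponents_colon_ideal:
  "exponents (colon_ideal I (Poly_Mapping.single w 1)) = (+) w -` exponents I"
  by (auto simp: exponents_def colon_ideal_def mult_single add.commute)

lemma monomial_ideal_colon:
  fixes I :: "('n, 'k::field) mpoly set"
  assumes mon: "monomial_ideal I"
  shows "monomial_ideal (colon_ideal I (Poly_Mapping.single w 1))"
proof (rule monomial_idealI)
  note D = ideal_polyringD[OF monomial_ideal_is_ideal[OF mon]]
  show "ideal (colon_ideal I (Poly_Mapping.single w 1)) polyring"
    by (rule ideal_polyringI) (auto simp: colon_ideal_def D distrib_right mult.assoc)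
  fix f assume "f \<in> colon_ideal I (Poly_Mapping.single w 1)"
  then have "Poly_Mapping.keys (f * Poly_Mapping.single w 1) \<subseteq> exponents I"
    by (simp add: colon_ideal_def monomial_ideal_mem_iff[OF mon])
  then show "Poly_Mapping.keys f \<subseteq> exponents (colon_ideal I (Poly_Mapping.single w 1))"
    unfolding exponents_colon_ideal by (auto simp: keys_mult_single add.commute)
qed

text \<open>Applied below with \<open>g = 0\<close> and \<open>g = v\<close>, to exclude that
  \<open>I'\<close> is zero or the whole ring.\<close>

lemma principal_idealI:
  fixes I :: "('n, 'k::field) mpoly set"
  assumes "ideal I polyring" "I = {f * g |f. True}"
  shows "principalideal I polyring"
proof -
  interpret cring "polyring :: ('n, 'k) mpoly ring" by (rule cring_polyring)
  have "I = PIdl\<^bsub>polyring\<^esub> g"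
    using assms(2) by (simp add: cgenideal_def)
  then show ?thesis
    using cgenideal_is_principalideal[of g] by simp
qed

section \<open>Comparing an exponent set, and its complement, with their translates\<close>

lemma block_depth_ge_less_card:
  fixes E :: "('n::finite \<Rightarrow>\<^sub>0 nat) set"
  assumes "block_depth_ge (- E) d" "E \<noteq> {}" "- E \<noteq> {}"
    and closed: "\<And>u s. u \<in> E \<Longrightarrow> s + u \<in> E"
  shows "d < CARD('n)"
proof -
  from assms(1) obtain P where P: "- E = (\<Union>(t, Z)\<in>P. block t Z)"
    "\<And>t Z. (t, Z) \<in> P \<Longrightarrow> d \<le> card Z"
    by (rule block_depth_geE) blast
  then obtain t Z where tZ: "(t, Z) \<in> P"
    using assms(3) by fastforce
  obtain u where u: "u \<in> E"
    using assms(2) by blast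
  \<comment> \<open>With all directions present the block would contain \<open>t + u\<close>, which
    stays in \<open>E\<close> by closure.\<close>
  have "t + u \<in> block t UNIV"
    by (rule add_mem_block) simp
  moreover have "block t Z \<subseteq> - E"
    using P(1) tZ by blast
  ultimately have "Z \<noteq> UNIV"
    using closed[OF u, of t] by auto
  then have "card Z < CARD('n)"
    by (intro psubset_card_mono) auto
  with P(2)[OF tZ] show ?thesis by simp
qed

lemma block_depth_ge_complement_iff:
  fixes E :: "('n::finite \<Rightarrow>\<^sub>0 nat) set"
  assumes "E \<noteq> {}" "- E \<noteq> {}" and closed: "\<And>u s. u \<in> E \<Longrightarrow> s + u \<in> E"
  shows "block_depth_ge (- (+) w ` E) d \<longleftrightarrow> block_depth_ge (- E) d"
proof
  \<comment> \<open>Injectivity of translation makes the complement of \<open>E\<close> a preimage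
    of the larger complement, and block depth passes to preimages.\<close>
  have "(+) w -` (- (+) w ` E) = - E"
    by auto
  then show "block_depth_ge (- (+) w ` E) d \<Longrightarrow> block_depth_ge (- E) d"
    using block_depth_ge_vimage[of "- (+) w ` E" d w] by simp
  assume d: "block_depth_ge (- E) d"
  \<comment> \<open>The strict bound \<open>d < CARD('n)\<close> is what lets the non-multiples,
    split into blocks of n - 1 directions, meet the bound \<open>d\<close>.\<close>
  have "block_depth_ge (- range ((+) w)) d"
    by (rule block_depth_ge_mono[OF block_depth_ge_not_multiple])
      (use block_depth_ge_less_card[OF d assms] in simp)
  then have "block_depth_ge (- range ((+) w) \<union> (+) w ` (- E)) d"
    by (rule block_depth_ge_Un[OF _ block_depth_ge_translate[OF d]]) auto
  moreover have "- range ((+) w) \<union> (+) w ` (- E) = - (+) w ` E"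
    by auto
  ultimately show "block_depth_ge (- (+) w ` E) d" by simp
qed

lemma block_depth_ge_translate_iff: "block_depth_ge ((+) w ` C) d \<longleftrightarrow> block_depth_ge C d"
proof -
  have "(+) w -` ((+) w ` C) = C"
    by auto
  then show ?thesis
    using block_depth_ge_translate[of C d w] block_depth_ge_vimage[of "(+) w ` C" d w] by auto
qed

theorem theorem1p4:
  fixes I I' :: "('n::finite, 'k::field) mpoly set" and v :: "('n, 'k) mpoly"
  assumes "monomial_ideal I"
    and "\<not> principalideal I polyring"
    and "v \<in> monomials"
    and "I' = colon_ideal I v"
    and "I = {v * f |f. f \<in> I'}"
  shows "sdepth (quotient_module I) = sdepth (quotient_module I') \<and>
    sdepth (ideal_module I) = sdepth (ideal_module I')"
proof -
  note mon = assms(1)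
  obtain w where v: "v = Poly_Mapping.single w 1"
    using assms(3) by (auto simp: monomials_def)
  have mon': "monomial_ideal I'"
    unfolding assms(4) v by (rule monomial_ideal_colon[OF mon])
  note I = monomial_ideal_is_ideal[OF mon] and I' = monomial_ideal_is_ideal[OF mon']
  let ?E' = "exponents I'"
  \<comment> \<open>One inclusion is the definition of the colon ideal; the other uses the
    factorisation of \<open>I\<close> through \<open>v\<close>.\<close>
  have E: "exponents I = (+) w ` ?E'"
  proof
    have "(+) w -` exponents I = ?E'"
      unfolding assms(4) v by (rule exponents_colon_ideal[symmetric])
    then show "(+) w ` ?E' \<subseteq> exponents I"
      by blast
    show "exponents I \<subseteq> (+) w ` ?E'"
    proof
      fix t assume "t \<in> exponents I"
      then obtain f where f: "f \<in> I'" "Poly_Mapping.single t 1 = f * v"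
        using assms(5) by (auto simp: exponents_def mult.commute)
      \<comment> \<open>Multiplication by \<open>v\<close> shifts exponents injectively, so
        \<open>f\<close> has a single exponent, and adding \<open>w\<close> to it gives
        \<open>t\<close>.\<close>
      have "{t} = (\<lambda>s. s + w) ` Poly_Mapping.keys f"
        using arg_cong[OF f(2), of Poly_Mapping.keys] by (simp add: v keys_mult_single)
      then show "t \<in> (+) w ` ?E'"
        using f(1) by (auto simp: monomial_ideal_mem_iff[OF mon'] add.commute)
    qed
  qed
  have closed: "s + u \<in> ?E'" if "u \<in> ?E'" for u s
    using ideal_polyringD(3)[OF I', of "Poly_Mapping.single u 1" "Poly_Mapping.single s 1"] that
    by (simp add: exponents_def mult_single)
  \<comment> \<open>Otherwise \<open>I\<close> is the zero ideal, generated by 0.\<close>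
  have E'_ne: "?E' \<noteq> {}"
  proof
    assume "?E' = {}"
    then have "I' = {0}"
      by (auto simp: monomial_ideal_mem_iff[OF mon'])
    then have "I = {f * 0 |f. True}"
      unfolding assms(5) by simp
    then show False
      using principal_idealI[OF I] assms(2) by blast
  qed
  \<comment> \<open>Otherwise \<open>I'\<close> is the whole ring and \<open>I\<close> is generated
    by \<open>v\<close>.\<close>
  have E'_ne_UNIV: "- ?E' \<noteq> {}"
  proof
    assume "- ?E' = {}"
    then have "I' = UNIV"
      by (auto simp: monomial_ideal_mem_iff[OF mon'])
    then have "I = {f * v |f. True}"
      using assms(5) by (simp add: mult.commute)
    then show False
      using principal_idealI[OF I] assms(2) by blast
  qed
  have E_ne_UNIV: "- exponents I \<noteq> {}"
  proof -
    have "(+) w -` (- (+) w ` ?E') = - ?E'"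
      by auto
    then show ?thesis
      unfolding E using E'_ne_UNIV by auto
  qed
  have E_ne: "exponents I \<noteq> {}"
    using E'_ne unfolding E by simp
  have "sdepth (quotient_module I) = Max {d. block_depth_ge (- exponents I) d}"
    by (rule monomial_module.sdepth_eq[OF monomial_module_quotient_module[OF mon] E_ne_UNIV])
  also have "\<dots> = Max {d. block_depth_ge (- ?E') d}"
    unfolding E by (simp only: block_depth_ge_complement_iff[OF E'_ne E'_ne_UNIV closed])
  also have "\<dots> = sdepth (quotient_module I')"
    by (rule monomial_module.sdepth_eq[OF monomial_module_quotient_module[OF mon'] E'_ne_UNIV, symmetric])
  finally have quot: "sdepth (quotient_module I) = sdepth (quotient_module I')" .
  have "sdepth (ideal_module I) = Max {d. block_depth_ge (exponents I) d}"
    by (rule monomial_module.sdepth_eq[OF monomial_module_ideal_module[OF mon] E_ne])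
  also have "\<dots> = Max {d. block_depth_ge ?E' d}"
    unfolding E by (simp only: block_depth_ge_translate_iff)
  also have "\<dots> = sdepth (ideal_module I')"
    by (rule monomial_module.sdepth_eq[OF monomial_module_ideal_module[OF mon'] E'_ne, symmetric])
  finally show ?thesis
    using quot by simp
qed

end
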